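(* The cut-property is direct sum closed for finite $3$-groups: if $H$ and $K$ are finite $3$-groups with the cut-property, then the direct sum $H \times K$ has the cut-property.
   Context: For a finite group $G$, let $\mathcal{U}(\mathbb{Z}[G])$ denote the group of units of the integral group ring $\mathbb{Z}[G]$ and $\mathcal{Z}(\cdot)$ the centre of a group. A finite group $G$ has the cut-property if all central units of $\mathbb{Z}[G]$ are trivial, i.e. $\mathcal{Z}(\mathcal{U}(\mathbb{Z}[G])) = \pm\mathcal{Z}(G) = \{\pm g : g \in \mathcal{Z}(G)\}$. *)

theory Defs
  imports "HOL-Algebra.Algebra"
begin

definition group_center :: "('a, 'm) monoid_scheme \<Rightarrow> 'a set" where
  "group_center G =
     {z \<in> carrier G. \<forall>x \<in> carrier G. z \<otimes>\<^bsub>G\<^esub> x = x \<otimes>\<^bsub>G\<^esub> z}"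

text \<open>
  An element of the integral group ring is its coefficient function, extended by \<open>0\<close>
  outside the group. The product is convolution summed over the whole group, so the
  definition is only meaningful for finite groups.
\<close>

definition int_group_ring :: "('a, 'm) monoid_scheme \<Rightarrow> ('a \<Rightarrow> int) ring" where
  "int_group_ring G =
     \<lparr>carrier = {f. \<forall>x. x \<notin> carrier G \<longrightarrow> f x = 0},
      monoid.mult = (\<lambda>f g x. if x \<in> carrier G
                then \<Sum>y \<in> carrier G. f y * g (inv\<^bsub>G\<^esub> y \<otimes>\<^bsub>G\<^esub> x) else 0),
      monoid.one = (\<lambda>x. if x = \<one>\<^bsub>G\<^esub> then 1 else 0),
      ring.zero = (\<lambda>x. 0),
      ring.add = (\<lambda>f g x. f x + g x)\<rparr>"

definition group_ring_elem :: "'a \<Rightarrow> 'a \<Rightarrow> int" where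
  "group_ring_elem g = (\<lambda>x. if x = g then 1 else 0)"

definition cut_property :: "('a, 'm) monoid_scheme \<Rightarrow> bool" where
  "cut_property G \<longleftrightarrow>
     group_center (units_of (int_group_ring G)) =
       (\<Union>z \<in> group_center G.
          {group_ring_elem z, \<ominus>\<^bsub>int_group_ring G\<^esub> group_ring_elem z})"

lemma (in group) ring_int_group_ring:
  assumes fin: "finite (carrier G)"
  shows "ring (int_group_ring G)"
proof -
  let ?R = "int_group_ring G"
  have ag: "abelian_group ?R"
  proof (rule abelian_groupI)
    fix f assume "f \<in> carrier ?R"
    then show "\<exists>g\<in>carrier ?R. g \<oplus>\<^bsub>?R\<^esub> f = \<zero>\<^bsub>?R\<^esub>"
      by (intro bexI[of _ "\<lambda>x. - f x"]) (auto simp: int_group_ring_def)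
  qed (auto simp: int_group_ring_def algebra_simps)
  have mon: "Group.monoid ?R"
  proof (rule monoidI)
    fix f g h assume fgh: "f \<in> carrier ?R" "g \<in> carrier ?R" "h \<in> carrier ?R"
    show "(f \<otimes>\<^bsub>?R\<^esub> g) \<otimes>\<^bsub>?R\<^esub> h = f \<otimes>\<^bsub>?R\<^esub> (g \<otimes>\<^bsub>?R\<^esub> h)"
    proof
      fix x
      show "((f \<otimes>\<^bsub>?R\<^esub> g) \<otimes>\<^bsub>?R\<^esub> h) x = (f \<otimes>\<^bsub>?R\<^esub> (g \<otimes>\<^bsub>?R\<^esub> h)) x"
      proof (cases "x \<in> carrier G")
        case x: True
        have "((f \<otimes>\<^bsub>?R\<^esub> g) \<otimes>\<^bsub>?R\<^esub> h) x =
          (\<Sum>y\<in>carrier G. \<Sum>z\<in>carrier G. f z * g (inv z \<otimes> y) * h (inv y \<otimes> x))"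
          using x by (simp add: int_group_ring_def sum_distrib_right)
        also have "\<dots> = (\<Sum>z\<in>carrier G. \<Sum>y\<in>carrier G. f z * g (inv z \<otimes> y) * h (inv y \<otimes> x))"
          by (rule sum.swap)
        also have "\<dots> = (\<Sum>z\<in>carrier G. \<Sum>w\<in>carrier G. f z * (g w * h (inv w \<otimes> (inv z \<otimes> x))))"
        proof (rule sum.cong[OF refl])
          fix z assume z: "z \<in> carrier G"
          have c: "z \<otimes> (inv z \<otimes> y) = y" "inv z \<otimes> (z \<otimes> y) = y" if "y \<in> carrier G" for y
            using z that by (simp_all flip: m_assoc)
          have d: "inv (inv z \<otimes> y) \<otimes> (inv z \<otimes> x) = inv y \<otimes> x" if "y \<in> carrier G" for y
            using z x that by (simp add: inv_mult_group m_assoc c)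
          show "(\<Sum>y\<in>carrier G. f z * g (inv z \<otimes> y) * h (inv y \<otimes> x)) =
            (\<Sum>w\<in>carrier G. f z * (g w * h (inv w \<otimes> (inv z \<otimes> x))))"
            by (rule sum.reindex_bij_witness[of _ "\<lambda>w. z \<otimes> w" "\<lambda>y. inv z \<otimes> y"])
              (use z x in \<open>auto simp: c d\<close>)
        qed
        also have "\<dots> = (f \<otimes>\<^bsub>?R\<^esub> (g \<otimes>\<^bsub>?R\<^esub> h)) x"
          using x by (simp add: int_group_ring_def sum_distrib_left)
        finally show ?thesis .
      qed (simp add: int_group_ring_def)
    qed
  next
    fix f assume f: "f \<in> carrier ?R"
    show "\<one>\<^bsub>?R\<^esub> \<otimes>\<^bsub>?R\<^esub> f = f"
      using f fin by (auto simp: int_group_ring_def fun_eq_iff if_distrib[of "\<lambda>c. c * _"]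
          sum.delta cong: if_cong)
    show "f \<otimes>\<^bsub>?R\<^esub> \<one>\<^bsub>?R\<^esub> = f"
    proof
      fix x
      show "(f \<otimes>\<^bsub>?R\<^esub> \<one>\<^bsub>?R\<^esub>) x = f x"
      proof (cases "x \<in> carrier G")
        case x: True
        have "inv y \<otimes> x = \<one> \<longleftrightarrow> y = x" if "y \<in> carrier G" for y
          using that x by (metis inv_closed inv_equality inv_inv l_inv)
        then have "(f \<otimes>\<^bsub>?R\<^esub> \<one>\<^bsub>?R\<^esub>) x = (\<Sum>y\<in>carrier G. if y = x then f y else 0)"
          using x by (auto simp: int_group_ring_def intro!: sum.cong)
        then show ?thesis using x fin by simp
      qed (use f in \<open>simp add: int_group_ring_def\<close>)
    qed
  qed (auto simp: int_group_ring_def)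
  show ?thesis
    by (rule ringI[OF ag mon])
      (auto simp: int_group_ring_def fun_eq_iff algebra_simps sum.distrib)
qed

end

theory Submission
  imports Defs
    "HOL-Probability.Discrete_Topology"
    "HOL-Number_Theory.Cong"
    "Jordan_Normal_Form.Schur_Decomposition"
begin

text \<open>
  The theorem follows from a criterion that is visibly inherited by direct products: a finite
  3-group \<open>G\<close> has the cut-property if and only if \<open>g\<^sup>2\<close> is conjugate to the inverse of \<open>g\<close> for
  every \<open>g\<close> in \<open>G\<close> (\<open>cut_property_three_group_iff\<close>). The unit group modulo \<open>3\<^sup>e\<close> is generated by
  \<open>2\<close>, so the condition says that every generator of a cyclic subgroup \<open>\<langle>g\<rangle>\<close> is conjugate to \<open>g\<close> or
  to its inverse. Both directions take place in the real group algebra with the involution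
  \<open>star\<close> that inverts group elements; the coefficient of \<open>a * star a\<close> at the identity is the sum
  of the squared coefficients of \<open>a\<close>, which makes self-adjoint elements behave like
  real symmetric matrices.

  Cut implies the criterion. Let \<open>g\<close> have order \<open>n\<close>, divisible by 9, and let \<open>j\<close> be prime to 3. The
  quotient \<open>(1 + g\<^sup>j) / (1 + g)\<close> is a unit of the integral group ring of \<open>\<langle>g\<rangle>\<close>. It equals
  \<open>exp y\<close> for an explicit real combination \<open>y\<close> of powers of \<open>g\<close> (\<open>exp_log1p\<close>). In a p-group
  normalizers grow, and climbing from \<open>\<langle>g\<rangle>\<close> to \<open>G\<close> through successive normalizers shows that the
  exponential of some positive multiple of the sum of all conjugates of \<open>y\<close> is integral
  (\<open>exp_trace_integral\<close>). This exponential is a central unit. If it is trivial, its product with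
  its star is 1, so the self-adjoint part of its logarithm is 0
  (\<open>exp_eq_one_self_adjoint\<close>). Comparing coefficients at the conjugates of \<open>g\<^sup>j\<close> gives a quantity
  that does not depend on \<open>j\<close> (\<open>log1p_invariant\<close>). If all \<open>k\<close> for which \<open>g\<^sup>k\<close> is conjugate to
  \<open>g\<close> were congruent to 1 or -1 modulo 9, summation over the \<open>j\<close> congruent to 1 or -1, and over those
  congruent to 2 or -2, would equate two integrals whose difference is
  the integral of \<open>(1 + t) (1 - t\<^sup>6) / (1 + t\<^sup>9)\<close> over the unit interval, which is positive.
  Hence some such \<open>k\<close> is 4 or 7 modulo 9, and its powers reach -2.

  The criterion implies cut. In a group of odd order every central unit becomes self-adjoint after
  multiplication with a suitable central group element, so let \<open>v\<close> be a self-adjoint central unit. Then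
  \<open>v\<^sup>2 = 1\<close> gives \<open>v * star v = 1\<close>, so \<open>v\<close> is trivial. If \<open>v\<^sup>2 \<noteq> 1\<close>, a polynomial in
  \<open>v\<close> is a nonzero idempotent \<open>a\<close> with \<open>v a = r a\<close> and \<open>r\<^sup>2 \<noteq> 1\<close>
  (\<open>self_adjoint_eigen_idempotent\<close>). By the criterion \<open>a\<close> is constant on the generators of every
  cyclic subgroup. The product of \<open>a\<close> with the averaging idempotent of such a subgroup is an idempotent,
  whose trace is an integer; so the sum of \<open>a\<close> over each cyclic subgroup is rational, and
  by induction all coefficients of \<open>a\<close> are rational (\<open>coef_idempotent_Rats\<close>). Then the
  coefficients of \<open>v\<^sup>k a = r\<^sup>k a\<close> have a denominator independent of \<open>k\<close>, and the same holds
  for the inverse of \<open>v\<close>, which forces \<open>r\<close> to be 1 or -1, a contradiction.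
\<close>

hide_const (open) Divisibility.prime Polynomial.order

section \<open>A Banach algebra around the group algebra\<close>

text \<open>
  Exponentials of elements of the group algebra are needed, so the algebra is placed inside a
  Banach algebra given by a type. Groups here are carrier sets, so the type can depend only on the
  type of the group elements: bounded operators on the space of all bounded functions on that type.
\<close>

typedef 'a operator =
  "UNIV :: (('a discrete \<Rightarrow>\<^sub>C real) \<Rightarrow>\<^sub>L ('a discrete \<Rightarrow>\<^sub>C real)) set"
  morphisms blinfun_of_operator operator_of_blinfun
  by simp

setup_lifting type_definition_operator

instantiation operator :: (type) real_normed_algebra_1
begin

lift_definition zero_operator :: "'a operator" is 0 .
lift_definition one_operator :: "'a operator" is id_blinfun .
lift_definition plus_operator :: "'a operator \<Rightarrow> 'a operator \<Rightarrow> 'a operator" is "(+)" .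
lift_definition minus_operator :: "'a operator \<Rightarrow> 'a operator \<Rightarrow> 'a operator" is "(-)" .
lift_definition uminus_operator :: "'a operator \<Rightarrow> 'a operator" is uminus .
lift_definition times_operator :: "'a operator \<Rightarrow> 'a operator \<Rightarrow> 'a operator"
  is blinfun_compose .
lift_definition scaleR_operator :: "real \<Rightarrow> 'a operator \<Rightarrow> 'a operator" is scaleR .
lift_definition norm_operator :: "'a operator \<Rightarrow> real" is norm .
definition sgn_operator :: "'a operator \<Rightarrow> 'a operator"
  where "sgn_operator A = inverse (norm A) *\<^sub>R A"
definition dist_operator :: "'a operator \<Rightarrow> 'a operator \<Rightarrow> real"
  where "dist_operator A B = norm (A - B)"
definition uniformity_operator :: "('a operator \<times> 'a operator) filter"
  where "uniformity_operator = (INF e\<in>{0 <..}. principal {(x, y). dist x y < e})"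
definition open_operator :: "'a operator set \<Rightarrow> bool"
  where "open_operator U = (\<forall>x\<in>U. eventually (\<lambda>(x', y). x' = x \<longrightarrow> y \<in> U) uniformity)"

lemma norm_id_operator: "norm (id_blinfun :: ('a discrete \<Rightarrow>\<^sub>C real) \<Rightarrow>\<^sub>L _) = 1"
proof (rule antisym)
  show "norm (id_blinfun :: ('a discrete \<Rightarrow>\<^sub>C real) \<Rightarrow>\<^sub>L _) \<le> 1"
    by (rule norm_blinfun_bound) auto
  let ?c = "const_bcontfun 1 :: 'a discrete \<Rightarrow>\<^sub>C real"
  have "?c \<noteq> 0"
    by (metis const_bcontfun.rep_eq zero_bcontfun.rep_eq zero_neq_one)
  then have "norm ?c > 0" by simp
  moreover have "norm (blinfun_apply id_blinfun ?c) \<le> norm (id_blinfun :: ('a discrete \<Rightarrow>\<^sub>C real) \<Rightarrow>\<^sub>L _) * norm ?c"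
    by (rule norm_blinfun)
  ultimately show "1 \<le> norm (id_blinfun :: ('a discrete \<Rightarrow>\<^sub>C real) \<Rightarrow>\<^sub>L _)"
    by simp
qed

instance
proof
  fix a b c :: "'a operator" and r s :: real
  show "(a * b) * c = a * (b * c)" by transfer (auto intro!: blinfun_eqI)
  show "(a + b) * c = a * c + b * c"
    by transfer (auto intro!: blinfun_eqI simp: blinfun.add_left)
  show "a * (b + c) = a * b + a * c"
    by transfer (auto intro!: blinfun_eqI simp: blinfun.add_left blinfun.add_right)
  show "1 * a = a" "a * 1 = a" by (transfer; auto intro!: blinfun_eqI)+
  show "(0::'a operator) \<noteq> 1" 
    by transfer (metis norm_id_operator norm_zero zero_neq_one)
  show "r *\<^sub>R a * b = r *\<^sub>R (a * b)" "a * r *\<^sub>R b = r *\<^sub>R (a * b)"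
    by (transfer; auto intro!: blinfun_eqI simp: blinfun.scaleR_left blinfun.scaleR_right)+
  show "norm (a * b) \<le> norm a * norm b" by transfer (rule norm_blinfun_compose)
  show "norm (1 :: 'a operator) = 1" by transfer (rule norm_id_operator)
  show "norm a = 0 \<longleftrightarrow> a = 0" "norm (r *\<^sub>R a) = \<bar>r\<bar> * norm a" by (transfer; simp)+
  show "norm (a + b) \<le> norm a + norm b" by transfer (rule norm_triangle_ineq)
  show "a + b + c = a + (b + c)" "a + b = b + a" "0 + a = a" "- a + a = 0" "a - b = a + - b"
    by (transfer; simp)+
  show "r *\<^sub>R (a + b) = r *\<^sub>R a + r *\<^sub>R b" "(r + s) *\<^sub>R a = r *\<^sub>R a + s *\<^sub>R a"
    "r *\<^sub>R s *\<^sub>R a = (r * s) *\<^sub>R a" "1 *\<^sub>R a = a"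
    by (transfer; simp add: scaleR_add_left scaleR_add_right)+
qed (rule sgn_operator_def dist_operator_def uniformity_operator_def open_operator_def)+

end

instance bcontfun :: (metric_space, banach) banach ..

instance operator :: (type) banach
proof
  fix u :: "nat \<Rightarrow> 'a operator"
  have d: "dist (blinfun_of_operator A) (blinfun_of_operator B) = dist A B" for A B :: "'a operator"
    unfolding dist_norm by transfer simp
  assume "Cauchy u"
  then have "Cauchy (\<lambda>n. blinfun_of_operator (u n))"
    by (simp add: Cauchy_def d)
  then obtain L where "(\<lambda>n. blinfun_of_operator (u n)) \<longlonglongrightarrow> L"
    using Cauchy_convergent convergent_def by blast
  then have "u \<longlonglongrightarrow> operator_of_blinfun L"
    by (simp add: lim_sequentially operator_of_blinfun_inverse flip: d)
  then show "convergent u" by (auto simp: convergent_def)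
qed


lemma bcontfun_discrete: "f \<in> bcontfun \<longleftrightarrow> bounded (range f)"
  for f :: "'a discrete \<Rightarrow> real"
  by (auto simp: bcontfun_def continuous_on_open_vimage open_discrete)

text \<open>
  Every self-map of the underlying type acts on bounded functions by composition. Left translation
  by a group element, extended by the identity outside the carrier, is such a map.
\<close>

definition pullback_fun :: "('a \<Rightarrow> 'a) \<Rightarrow> ('a discrete \<Rightarrow>\<^sub>C real) \<Rightarrow> ('a discrete \<Rightarrow>\<^sub>C real)" where
  "pullback_fun p f = Bcontfun (\<lambda>y. apply_bcontfun f (discrete (p (of_discrete y))))"

lemma apply_pullback_fun [simp]:
  "apply_bcontfun (pullback_fun p f) y = apply_bcontfun f (discrete (p (of_discrete y)))"
proof -
  have "bounded (range (\<lambda>y. apply_bcontfun f (discrete (p (of_discrete y)))))"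
    by (rule bounded_subset[OF bounded_apply_bcontfun[of f]]) auto
  then show ?thesis
    by (simp add: pullback_fun_def Bcontfun_inverse bcontfun_discrete)
qed

lemma norm_pullback_fun: "norm (pullback_fun p f) \<le> norm f"
  by (rule norm_bound) (subst apply_pullback_fun, rule norm_bounded)

lemma bounded_linear_pullback_fun: "bounded_linear (pullback_fun p)"
  by (rule bounded_linear_intro[of _ 1])
    (auto intro!: bcontfun_eqI simp: plus_bcontfun.rep_eq scaleR_bcontfun.rep_eq norm_pullback_fun)

definition pullback :: "('a \<Rightarrow> 'a) \<Rightarrow> 'a operator" where
  "pullback p = operator_of_blinfun (Blinfun (pullback_fun p))"

lemma blinfun_pullback: "blinfun_apply (blinfun_of_operator (pullback p)) = pullback_fun p"
  by (simp add: pullback_def operator_of_blinfun_inverse bounded_linear_Blinfun_apply bounded_linear_pullback_fun)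

lemma operator_eqI:
  assumes "\<And>f. blinfun_apply (blinfun_of_operator A) f = blinfun_apply (blinfun_of_operator B) f"
  shows "A = B"
  using assms by (metis blinfun_eqI blinfun_of_operator_inject)

lemma pullback_mult: "pullback p * pullback q = pullback (\<lambda>x. q (p x))"
  by (rule operator_eqI)
    (auto simp: times_operator.rep_eq blinfun_pullback discrete_inverse intro!: bcontfun_eqI)

lemma pullback_id: "pullback (\<lambda>x. x) = 1"
  by (rule operator_eqI)
    (auto simp: one_operator.rep_eq blinfun_pullback of_discrete_inverse intro!: bcontfun_eqI)

definition indicator_fun :: "'a \<Rightarrow> ('a discrete \<Rightarrow>\<^sub>C real)" where
  "indicator_fun a = Bcontfun (\<lambda>y. if of_discrete y = a then 1 else 0)"

lemma apply_indicator_fun [simp]: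
  "apply_bcontfun (indicator_fun a) y = (if of_discrete y = a then 1 else 0)"
proof -
  have "bounded (range (\<lambda>y :: 'a discrete. if of_discrete y = a then 1 else 0 :: real))"
    by (rule finite_imp_bounded, rule finite_subset[of _ "{0, 1}"]) auto
  then show ?thesis
    by (simp add: indicator_fun_def Bcontfun_inverse bcontfun_discrete)
qed

locale fin_group = group G for G (structure) +
  assumes fin: "finite (carrier G)"
begin

text \<open>
  The value at \<open>x\<close> of an operator applied to the indicator of the identity; on a real combination of
  translations this reads off the coefficient of \<open>x\<close>. Being defined on all operators, it is a
  continuous functional and passes through exponential series.
\<close>

definition coef :: "'a \<Rightarrow> 'a operator \<Rightarrow> real" where
  "coef x A =
     apply_bcontfun (blinfun_apply (blinfun_of_operator A) (indicator_fun \<one>)) (discrete x)"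

lemma bounded_linear_coef: "bounded_linear (coef x)"
proof (rule bounded_linear_intro)
  fix A :: "'a operator"
  have "norm (coef x A) \<le> norm (blinfun_apply (blinfun_of_operator A) (indicator_fun \<one>))"
    unfolding coef_def by (rule norm_bounded)
  also have "\<dots> \<le> norm A * norm (indicator_fun \<one>)"
    unfolding norm_operator.rep_eq by (rule norm_blinfun)
  finally show "norm (coef x A) \<le> norm A * norm (indicator_fun \<one>)" .
qed (auto simp: coef_def plus_operator.rep_eq scaleR_operator.rep_eq blinfun.add_left
      blinfun.scaleR_left plus_bcontfun.rep_eq scaleR_bcontfun.rep_eq)

text \<open>
  Left translation by \<open>x\<close>: the image of the group element \<open>x\<close> in the algebra of operators.
\<close>

definition T :: "'a \<Rightarrow> 'a operator" where
  "T x = pullback (\<lambda>y. if y \<in> carrier G then inv x \<otimes> y else y)"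

lemma T_mult:
  assumes "x \<in> carrier G" "y \<in> carrier G"
  shows "T (x \<otimes> y) = T x * T y"
proof -
  have "(\<lambda>z. if z \<in> carrier G then inv (x \<otimes> y) \<otimes> z else z) =
    (\<lambda>z. (\<lambda>z. if z \<in> carrier G then inv y \<otimes> z else z) (if z \<in> carrier G then inv x \<otimes> z else z))"
    using assms by (auto simp: inv_mult_group m_assoc)
  then show ?thesis by (simp add: T_def pullback_mult)
qed

lemma T_one: "T \<one> = 1"
proof -
  have "(\<lambda>z. if z \<in> carrier G then inv \<one> \<otimes> z else z) = (\<lambda>z. z)" by auto
  then show ?thesis by (simp add: T_def pullback_id)
qed

lemma coef_T:
  assumes "x \<in> carrier G" "y \<in> carrier G"
  shows "coef y (T x) = (if x = y then 1 else 0)"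
proof -
  have "inv x \<otimes> y = \<one> \<longleftrightarrow> x = y"
    using assms by (metis inv_closed inv_equality inv_inv l_inv)
  then show ?thesis
    using assms by (simp add: coef_def T_def blinfun_pullback discrete_inverse)
qed

end

section \<open>The real group algebra: coefficients, involution, conjugation, exponential\<close>

context fin_group
begin

definition group_alg :: "'a operator set" where
  "group_alg = span (T ` carrier G)"

definition int_group_alg :: "'a operator set" where
  "int_group_alg = {a \<in> group_alg. \<forall>x \<in> carrier G. coef x a \<in> \<int>}"

lemma coef_simps [simp]:
  "coef x (a + b) = coef x a + coef x b" "coef x (a - b) = coef x a - coef x b"
  "coef x (- a) = - coef x a" "coef x (r *\<^sub>R a) = r * coef x a" "coef x 0 = 0"
  "coef x (sum f I) = (\<Sum>i\<in>I. coef x (f i))"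
proof -
  interpret bounded_linear "coef x" by (rule bounded_linear_coef)
  show "coef x (a + b) = coef x a + coef x b" "coef x (a - b) = coef x a - coef x b"
  "coef x (- a) = - coef x a" "coef x (r *\<^sub>R a) = r * coef x a" "coef x 0 = 0"
  "coef x (sum f I) = (\<Sum>i\<in>I. coef x (f i))"
    by (simp_all add: add diff neg scaleR zero sum)
qed

lemma T_in_group_alg [simp]: "x \<in> carrier G \<Longrightarrow> T x \<in> group_alg"
  by (auto simp: group_alg_def intro: span_base)

lemma group_alg_expand:
  assumes "a \<in> group_alg"
  shows "a = (\<Sum>x\<in>carrier G. coef x a *\<^sub>R T x)"
  using assms unfolding group_alg_def
proof (induction rule: span_induct_alt)
  case base
  show ?case by simp
next
  case (step c t b)
  then obtain y where y: "y \<in> carrier G" "t = T y" by auto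
  have "(\<Sum>x\<in>carrier G. coef x (T y) *\<^sub>R T x) = (\<Sum>x\<in>carrier G. if x = y then T x else 0)"
    using y by (intro sum.cong) (auto simp: coef_T)
  also have "\<dots> = T y" using fin y by simp
  finally have "(\<Sum>x\<in>carrier G. (c * coef x (T y)) *\<^sub>R T x) = c *\<^sub>R T y"
    by (simp flip: scaleR_scaleR scaleR_sum_right)
  then show ?case
    using step.IH y by (simp add: scaleR_add_left sum.distrib)
qed

lemma group_alg_eqI:
  assumes "a \<in> group_alg" "b \<in> group_alg" "\<And>x. x \<in> carrier G \<Longrightarrow> coef x a = coef x b"
  shows "a = b"
  by (subst group_alg_expand[OF assms(1)], subst group_alg_expand[OF assms(2)]) (simp add: assms(3))

lemma group_alg_closed [simp]:
  "0 \<in> group_alg" "1 \<in> group_alg"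
  "a \<in> group_alg \<Longrightarrow> b \<in> group_alg \<Longrightarrow> a + b \<in> group_alg"
  "a \<in> group_alg \<Longrightarrow> b \<in> group_alg \<Longrightarrow> a - b \<in> group_alg"
  "a \<in> group_alg \<Longrightarrow> - a \<in> group_alg"
  "a \<in> group_alg \<Longrightarrow> r *\<^sub>R a \<in> group_alg"
  "(\<And>i. i \<in> I \<Longrightarrow> f i \<in> group_alg) \<Longrightarrow> sum f I \<in> group_alg"
  using T_in_group_alg[OF one_closed]
  by (auto simp: group_alg_def T_one span_zero span_add span_diff span_neg span_scale intro: span_sum)

lemma group_alg_mult [simp]:
  assumes "a \<in> group_alg" "b \<in> group_alg"
  shows "a * b \<in> group_alg"
  by (subst group_alg_expand[OF assms(1)], subst group_alg_expand[OF assms(2)])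
    (simp add: sum_product flip: T_mult)

lemma group_alg_power [simp]: "a \<in> group_alg \<Longrightarrow> a ^ n \<in> group_alg"
  by (induction n) auto

lemma coef_T_mult:
  assumes "x \<in> carrier G" "y \<in> carrier G" "b \<in> group_alg"
  shows "coef x (T y * b) = coef (inv y \<otimes> x) b"
proof -
  have "T y * b = (\<Sum>z\<in>carrier G. coef z b *\<^sub>R T (y \<otimes> z))"
    using assms by (subst group_alg_expand[OF assms(3)]) (simp add: sum_distrib_left T_mult)
  also have "coef x \<dots> = (\<Sum>z\<in>carrier G. if z = inv y \<otimes> x then coef z b else 0)"
    using assms by (auto simp: coef_T inv_solve_left intro!: sum.cong)
  also have "\<dots> = coef (inv y \<otimes> x) b" using assms fin by simp
  finally show ?thesis .
qed

lemma coef_mult_T: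
  assumes "x \<in> carrier G" "y \<in> carrier G" "b \<in> group_alg"
  shows "coef x (b * T y) = coef (x \<otimes> inv y) b"
proof -
  have "b * T y = (\<Sum>z\<in>carrier G. coef z b *\<^sub>R T (z \<otimes> y))"
    using assms by (subst group_alg_expand[OF assms(3)]) (simp add: sum_distrib_right T_mult)
  also have "coef x \<dots> = (\<Sum>z\<in>carrier G. if z = x \<otimes> inv y then coef z b else 0)"
    using assms by (auto simp: coef_T inv_solve_right intro!: sum.cong)
  also have "\<dots> = coef (x \<otimes> inv y) b" using assms fin by simp
  finally show ?thesis .
qed

lemma coef_mult:
  assumes "x \<in> carrier G" "a \<in> group_alg" "b \<in> group_alg"
  shows "coef x (a * b) = (\<Sum>y\<in>carrier G. coef y a * coef (inv y \<otimes> x) b)"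
  by (subst group_alg_expand[OF assms(2)]) (simp add: sum_distrib_right assms coef_T_mult)

lemma int_group_alg_D: "a \<in> int_group_alg \<Longrightarrow> a \<in> group_alg"
  "a \<in> int_group_alg \<Longrightarrow> x \<in> carrier G \<Longrightarrow> coef x a \<in> \<int>"
  by (auto simp: int_group_alg_def)

lemma T_in_int_group_alg [simp]: "x \<in> carrier G \<Longrightarrow> T x \<in> int_group_alg"
  by (auto simp: int_group_alg_def coef_T)

lemma int_group_alg_closed [simp]:
  "0 \<in> int_group_alg" "1 \<in> int_group_alg"
  "a \<in> int_group_alg \<Longrightarrow> b \<in> int_group_alg \<Longrightarrow> a + b \<in> int_group_alg"
  "a \<in> int_group_alg \<Longrightarrow> b \<in> int_group_alg \<Longrightarrow> a - b \<in> int_group_alg"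
  "a \<in> int_group_alg \<Longrightarrow> - a \<in> int_group_alg"
  "a \<in> int_group_alg \<Longrightarrow> b \<in> int_group_alg \<Longrightarrow> a * b \<in> int_group_alg"
  "(\<And>i. i \<in> I \<Longrightarrow> f i \<in> int_group_alg) \<Longrightarrow> sum f I \<in> int_group_alg"
  using T_in_int_group_alg[OF one_closed]
  by (auto simp: int_group_alg_def T_one coef_mult intro!: Ints_sum Ints_mult)

lemma int_group_alg_power [simp]: "a \<in> int_group_alg \<Longrightarrow> a ^ n \<in> int_group_alg"
  by (induction n) auto

text \<open>
  The anti-automorphism of the group algebra that inverts group elements. It is defined through
  coefficients on all operators so that it is a bounded linear map.
\<close>

definition star :: "'a operator \<Rightarrow> 'a operator" where
  "star a = (\<Sum>x\<in>carrier G. coef x a *\<^sub>R T (inv x))"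

lemma bounded_linear_star: "bounded_linear star"
  unfolding star_def
  by (intro bounded_linear_sum bounded_linear_compose[OF bounded_linear_scaleR_left bounded_linear_coef])

lemma star_in_group_alg [simp]: "star a \<in> group_alg"
  by (auto simp: star_def)

lemma star_linear [simp]:
  "star (a + b) = star a + star b" "star (a - b) = star a - star b"
  "star (- a) = - star a" "star (r *\<^sub>R a) = r *\<^sub>R star a" "star 0 = 0"
  "star (sum f I) = (\<Sum>i\<in>I. star (f i))"
proof -
  interpret bounded_linear star by (rule bounded_linear_star)
  show "star (a + b) = star a + star b" "star (a - b) = star a - star b"
  "star (- a) = - star a" "star (r *\<^sub>R a) = r *\<^sub>R star a" "star 0 = 0"
  "star (sum f I) = (\<Sum>i\<in>I. star (f i))"
    by (simp_all add: add diff neg scaleR zero sum)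
qed

lemma coef_star: 
  assumes "x \<in> carrier G"
  shows "coef x (star a) = coef (inv x) a"
proof -
  have "coef x (star a) = (\<Sum>z\<in>carrier G. if z = inv x then coef z a else 0)"
    using assms by (auto simp: star_def coef_T intro!: sum.cong)
  then show ?thesis using assms fin by simp
qed

lemma star_T: "x \<in> carrier G \<Longrightarrow> star (T x) = T (inv x)"
  by (rule group_alg_eqI) (auto simp: coef_star coef_T)

lemma star_one [simp]: "star 1 = 1"
  using star_T[OF one_closed] by (simp add: T_one)

lemma star_star [simp]: "a \<in> group_alg \<Longrightarrow> star (star a) = a"
  by (rule group_alg_eqI) (auto simp: coef_star)

lemma star_in_int_group_alg [simp]: "a \<in> int_group_alg \<Longrightarrow> star a \<in> int_group_alg"
  by (auto simp: int_group_alg_def coef_star)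

lemma star_mult:
  assumes "a \<in> group_alg" "b \<in> group_alg"
  shows "star (a * b) = star b * star a"
proof -
  have "star (a * b) = (\<Sum>x\<in>carrier G. \<Sum>y\<in>carrier G. (coef x a * coef y b) *\<^sub>R star (T (x \<otimes> y)))"
    by (subst group_alg_expand[OF assms(1)], subst group_alg_expand[OF assms(2)], subst sum_product)
      (simp add: T_mult mult.commute)
  also have "\<dots> = (\<Sum>x\<in>carrier G. \<Sum>y\<in>carrier G. (coef x a * coef y b) *\<^sub>R (T (inv y) * T (inv x)))"
    by (intro sum.cong) (auto simp: star_T inv_mult_group simp flip: T_mult)
  also have "\<dots> = star b * star a"
    by (subst sum.swap) (simp add: star_def sum_product mult.commute)
  finally show ?thesis .
qed

lemma star_power: "a \<in> group_alg \<Longrightarrow> star (a ^ n) = star a ^ n"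
  by (induction n) (auto simp: star_mult power_commutes)

lemma coef_one_mult_star:
  assumes "a \<in> group_alg"
  shows "coef \<one> (a * star a) = (\<Sum>x\<in>carrier G. (coef x a)\<^sup>2)"
  using assms by (simp add: coef_mult coef_star power2_eq_square)

lemma coef_one_mult_star_eq_0:
  assumes "a \<in> group_alg" "coef \<one> (a * star a) \<le> 0"
  shows "a = 0"
proof (rule group_alg_eqI)
  fix x assume x: "x \<in> carrier G"
  have "(\<Sum>x\<in>carrier G. (coef x a)\<^sup>2) = 0"
    using assms by (intro antisym sum_nonneg) (auto simp: coef_one_mult_star)
  then show "coef x a = coef x 0" using x fin by (simp add: sum_nonneg_eq_0_iff)
qed (use assms in auto)

definition conj_by :: "'a \<Rightarrow> 'a operator \<Rightarrow> 'a operator" where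
  "conj_by x a = T x * a * T (inv x)"

lemma T_inv [simp]:
  assumes "x \<in> carrier G"
  shows "T x * T (inv x) = 1" "T (inv x) * T x = 1" 
    "T x * (T (inv x) * a) = a" "T (inv x) * (T x * a) = a"
  using assms by (simp_all flip: T_mult mult.assoc add: T_one)

lemma conj_linear:
  "conj_by x (a + b) = conj_by x a + conj_by x b" "conj_by x (- a) = - conj_by x a" 
  "conj_by x (r *\<^sub>R a) = r *\<^sub>R conj_by x a" "conj_by x (sum f I) = (\<Sum>i\<in>I. conj_by x (f i))"
  by (simp_all add: conj_by_def algebra_simps sum_distrib_left sum_distrib_right)

lemma conj_in [simp]: "x \<in> carrier G \<Longrightarrow> a \<in> group_alg \<Longrightarrow> conj_by x a \<in> group_alg"
  "x \<in> carrier G \<Longrightarrow> a \<in> int_group_alg \<Longrightarrow> conj_by x a \<in> int_group_alg"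
  by (simp_all add: conj_by_def)

lemma conj_mult: "x \<in> carrier G \<Longrightarrow> conj_by x (a * b) = conj_by x a * conj_by x b"
  by (simp add: conj_by_def mult.assoc)

lemma conj_power: "x \<in> carrier G \<Longrightarrow> conj_by x (a ^ n) = conj_by x a ^ n"
  by (induction n) (simp_all add: conj_mult, simp add: conj_by_def)

lemma conj_conj: "x \<in> carrier G \<Longrightarrow> y \<in> carrier G \<Longrightarrow> conj_by x (conj_by y a) = conj_by (x \<otimes> y) a"
  by (simp add: conj_by_def T_mult inv_mult_group mult.assoc)

lemma conj_T: "x \<in> carrier G \<Longrightarrow> y \<in> carrier G \<Longrightarrow> conj_by x (T y) = T (x \<otimes> y \<otimes> inv x)"
  by (simp add: conj_by_def T_mult)

lemma conj_eq_iff: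
  "x \<in> carrier G \<Longrightarrow> conj_by x a = a \<longleftrightarrow> T x * a = a * T x"
proof -
  assume x: "x \<in> carrier G"
  show "conj_by x a = a \<longleftrightarrow> T x * a = a * T x"
  proof
    assume "conj_by x a = a"
    then have "conj_by x a * T x = a * T x" by simp
    then show "T x * a = a * T x" using x by (simp add: conj_by_def mult.assoc)
  next
    assume "T x * a = a * T x"
    then show "conj_by x a = a" using x by (simp add: conj_by_def mult.assoc)
  qed
qed

lemma coef_conj:
  assumes "x \<in> carrier G" "z \<in> carrier G" "a \<in> group_alg"
  shows "coef z (conj_by x a) = coef (inv x \<otimes> z \<otimes> x) a"
  using assms by (simp add: conj_by_def coef_mult_T coef_T_mult m_assoc)

lemma bounded_linear_conj: "bounded_linear (conj_by x)"
  unfolding conj_by_def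
  by (intro bounded_linear_compose[OF bounded_linear_mult_left] bounded_linear_mult_right)

end

lemma bounded_linear_exp:
  fixes h :: "'b :: {real_normed_algebra_1,banach} \<Rightarrow> 'b"
  assumes "bounded_linear h" "\<And>n. h (y ^ n) = h y ^ n"
  shows "h (exp y) = exp (h y)"
proof -
  interpret bounded_linear h by fact
  have "(\<lambda>n. h (y ^ n /\<^sub>R fact n)) sums h (exp y)"
    by (rule sums[OF exp_converges])
  moreover have "(\<lambda>n. h (y ^ n /\<^sub>R fact n)) = (\<lambda>n. h y ^ n /\<^sub>R fact n)"
    by (simp add: scaleR assms)
  ultimately show ?thesis
    using exp_converges[of "h y"] sums_unique2 by metis
qed

context fin_group
begin

lemma exp_star: "y \<in> group_alg \<Longrightarrow> star (exp y) = exp (star y)"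
  by (rule bounded_linear_exp[OF bounded_linear_star]) (rule star_power)

lemma exp_conj: "x \<in> carrier G \<Longrightarrow> conj_by x (exp y) = exp (conj_by x y)"
  by (rule bounded_linear_exp[OF bounded_linear_conj]) (rule conj_power)

text \<open>
  At the identity, the even part of the exponential series has the coefficient 1 plus half the sum of the
  squared coefficients of \<open>y\<close> plus further nonnegative terms, because the coefficient of
  \<open>y ^ (2 * k) = y ^ k * star (y ^ k)\<close> there is a sum of squares. If \<open>exp y\<close>, and
  therefore \<open>exp (- y)\<close>, equals 1, the quadratic term must vanish.
\<close>

lemma exp_eq_one_self_adjoint:
  assumes y: "y \<in> group_alg" "star y = y" and "exp y = 1"
  shows "y = 0"
proof -
  have "exp (- y) = 1"
    using assms(3) exp_minus_inverse[of y] by simp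
  define f where "f n = (coef \<one> (y ^ n) + coef \<one> ((- y) ^ n)) / fact n" for n
  have "(\<lambda>n. coef \<one> (y ^ n /\<^sub>R fact n + (- y) ^ n /\<^sub>R fact n)) sums coef \<one> (exp y + exp (- y))"
    by (intro bounded_linear.sums[OF bounded_linear_coef] sums_add exp_converges)
  moreover have "(\<lambda>n. coef \<one> (y ^ n /\<^sub>R fact n + (- y) ^ n /\<^sub>R fact n)) = f"
    by (simp add: f_def fun_eq_iff field_simps)
  moreover have "coef \<one> (exp y + exp (- y)) = 2"
    using coef_T[OF one_closed one_closed] unfolding assms(3) \<open>exp (- y) = 1\<close> coef_simps by (simp add: T_one)
  ultimately have f: "f sums 2" by simp
  have f0: "f 0 = 2" 
    using coef_T[OF one_closed one_closed] by (simp add: f_def T_one)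
  have pos: "f n \<ge> 0" for n
  proof (cases "even n")
    case True
    then obtain k where k: "n = k + k" by (metis evenE mult_2)
    have "coef \<one> (y ^ n) = coef \<one> (y ^ k * star (y ^ k))"
      using y by (simp add: k power_add star_power)
    also have "\<dots> \<ge> 0"
      using y by (subst coef_one_mult_star) (auto intro: sum_nonneg)
    finally show ?thesis using True by (simp add: f_def)
  qed (simp add: f_def)
  have "sum f {0, 2} \<le> 2"
    using sum_le_suminf[of f "{0, 2}"] f pos by (auto simp: sums_iff)
  then have "coef \<one> (y * star y) \<le> 0"
    using y f0 by (simp add: f_def power2_eq_square)
  then show ?thesis using y by (intro coef_one_mult_star_eq_0)
qed

end

section \<open>Exponentials of traces over a p-group\<close>

text \<open>
  All orbits of a p-group have p-power size, so the number of fixed points in an invariant set of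
  size divisible by \<open>p\<close> is divisible by \<open>p\<close>; it cannot be exactly one.
\<close>

lemma (in group_action) p_group_second_fixed_point:
  assumes p: "prime (p :: nat)" "order G = p ^ m"
    and F: "finite F" "F \<subseteq> E" "\<And>g x. g \<in> carrier G \<Longrightarrow> x \<in> F \<Longrightarrow> \<phi> g x \<in> F" "p dvd card F"
    and x0: "x0 \<in> F" "\<And>g. g \<in> carrier G \<Longrightarrow> \<phi> g x0 = x0"
  obtains x where "x \<in> F" "x \<noteq> x0" "\<And>g. g \<in> carrier G \<Longrightarrow> \<phi> g x = x"
proof -
  have "\<exists>x\<in>F. x \<noteq> x0 \<and> (\<forall>g\<in>carrier G. \<phi> g x = x)"
  proof (rule ccontr)
    assume contra: "\<not> ?thesis"
    let ?O = "orbit G \<phi> ` (F - {x0})"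
    have sub: "orbit G \<phi> x \<subseteq> F - {x0}" if x: "x \<in> F - {x0}" for x
    proof
      fix y assume "y \<in> orbit G \<phi> x"
      then obtain g where g: "g \<in> carrier G" "y = \<phi> g x" by (auto simp: orbit_def)
      have "y \<noteq> x0"
      proof
        assume "y = x0"
        then have "\<phi> g x = \<phi> g x0" using g x0 by simp
        then have "x = x0" 
          using inj_prop[OF g(1)] x F x0 by (auto simp: inj_on_def)
        then show False using x by simp
      qed
      then show "y \<in> F - {x0}" using g x F by auto
    qed
    have un: "\<Union>?O = F - {x0}"
    proof
      show "\<Union>?O \<subseteq> F - {x0}" using sub by blast
      show "F - {x0} \<subseteq> \<Union>?O" using orbit_refl F(2) by blast
    qed
    have "p dvd card c" if "c \<in> ?O" for c
    proof -
      from that obtain x where x: "x \<in> F - {x0}" and c: "c = orbit G \<phi> x" by auto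
      have "card c dvd p ^ m"
        using orbit_stabilizer_theorem[of x] x F p by (metis c Diff_iff dvd_triv_left subsetD)
      moreover have "card c \<noteq> 1"
      proof
        assume "card c = 1"
        then have "c = {x}" using orbit_refl[of x] x F by (auto simp: c card_1_singleton_iff)
        then have "\<forall>g\<in>carrier G. \<phi> g x = x" by (auto simp: c orbit_def)
        then show False using contra x by auto
      qed
      ultimately show ?thesis using p(1)
        by (auto simp: divides_primepow_nat)
    qed
    moreover have "\<And>c d. c \<in> ?O \<Longrightarrow> d \<in> ?O \<Longrightarrow> c \<noteq> d \<Longrightarrow> c \<inter> d = {}"
    proof -
      fix c d assume "c \<in> ?O" "d \<in> ?O" "c \<noteq> d"
      then have "c \<in> orbits G E \<phi>" "d \<in> orbits G E \<phi>" using F(2) unfolding orbits_def by blast+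
      with \<open>c \<noteq> d\<close> show "c \<inter> d = {}" using disjoint_union by blast
    qed
    ultimately have "p dvd card (\<Union>?O)"
      using F un by (intro dvd_partition) auto
    then have "p dvd card F - 1" using un F x0 by simp
    moreover have "card F \<ge> 1" using F x0 by (metis One_nat_def Suc_leI card_gt_0_iff empty_iff)
    ultimately have "p dvd 1" using F(4) by (metis dvd_diff_nat diff_diff_cancel)
    then show False using p by simp
  qed
  then show ?thesis using that by blast
qed

lemma (in group) set_conj_normalizer:
  assumes "subgroup C G" "x \<in> normalizer G C" "c \<in> C"
  shows "x \<otimes> c \<otimes> inv x \<in> C"
proof -
  have "C \<subseteq> carrier G" using assms subgroup.subset by blast
  then have "x <# C #> inv x = C" "x \<in> carrier G"
    using assms by (auto simp: normalizer_def stabilizer_def)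
  then show ?thesis using assms by (auto simp: l_coset_def r_coset_def)
qed

lemma (in monoid) conj_coset_image: "g <# C #> inv g = (\<lambda>c. g \<otimes> c \<otimes> inv g) ` C"
  by (auto simp: l_coset_def r_coset_def)

lemma (in group) conj_inverse_cancel:
  assumes "g \<in> carrier G" "c \<in> carrier G"
  shows "g \<otimes> (inv g \<otimes> c \<otimes> g) \<otimes> inv g = c"
proof -
  have "g \<otimes> (inv g \<otimes> c \<otimes> g) \<otimes> inv g = (g \<otimes> inv g) \<otimes> c \<otimes> (g \<otimes> inv g)"
    using assms by (simp only: m_assoc inv_closed m_closed)
  then show ?thesis using assms by simp
qed

text \<open>
  The stabilizer of \<open>x\<close> fixes \<open>x\<close>, hence a second point \<open>g x\<close> of the orbit; then it is contained in
  the stabilizer of \<open>g x\<close>, which is its own conjugate by \<open>g\<close>.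
\<close>

lemma (in group_action) p_group_stabilizer_conjugate:
  assumes fin: "finite (carrier G)" and p: "prime (p :: nat)" "order G = p ^ m"
    and x: "x \<in> E" "orbit G \<phi> x \<noteq> {x}"
  obtains g where "g \<in> carrier G" "\<phi> g x \<noteq> x"
    "\<And>c. c \<in> stabilizer G \<phi> x \<Longrightarrow> inv g \<otimes> c \<otimes> g \<in> stabilizer G \<phi> x"
proof -
  let ?S = "stabilizer G \<phi> x" and ?F = "orbit G \<phi> x"
  interpret G: group G using group_hom group_hom.axioms(1) by blast
  interpret S: subgroup ?S G by (rule stabilizer_subgroup[OF x(1)])
  interpret actS: group_action "G\<lparr>carrier := ?S\<rparr>" E \<phi>
    by (rule induced_action[OF S.subgroup_axioms])
  have card: "card ?F * card ?S = p ^ m"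
    using orbit_stabilizer_theorem[OF x(1)] p by simp
  have xF: "x \<in> ?F" by (rule orbit_refl[OF x(1)])
  have "card ?F \<noteq> 1" using x xF by (auto simp: card_1_singleton_iff)
  moreover have "card ?F dvd p ^ m" using card by (metis dvd_triv_left)
  ultimately have pF: "p dvd card ?F" using p by (auto simp: divides_primepow_nat)
  have "card ?S dvd p ^ m" using card by (metis dvd_triv_right)
  then obtain k where k: "order (G\<lparr>carrier := ?S\<rparr>) = p ^ k"
    using p by (auto simp: Coset.order_def divides_primepow_nat)
  have finF: "finite ?F" using fin by (simp add: orbit_def)
  have FE: "?F \<subseteq> E" using element_image x(1) by (auto simp: orbit_def)
  have stable: "\<phi> g y \<in> ?F" if g: "g \<in> ?S" and y: "y \<in> ?F" for g y
  proof -
    obtain h where h: "h \<in> carrier G" "y = \<phi> h x" using y by (auto simp: orbit_def)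
    have "\<phi> g y = \<phi> (g \<otimes> h) x" using composition_rule[OF x(1), of g h] h g S.mem_carrier by simp
    then show ?thesis using g h S.mem_carrier by (auto simp: orbit_def)
  qed
  have fix_x: "\<phi> g x = x" if "g \<in> ?S" for g
    using that unfolding stabilizer_def by blast
  obtain y where y: "y \<in> ?F" "y \<noteq> x" "\<And>g. g \<in> ?S \<Longrightarrow> \<phi> g y = y"
  proof (rule actS.p_group_second_fixed_point[OF p(1) k finF FE _ pF xF])
    fix g y assume "g \<in> carrier (G\<lparr>carrier := ?S\<rparr>)" "y \<in> ?F"
    then show "\<phi> g y \<in> ?F" using stable by simp
  next
    fix g assume "g \<in> carrier (G\<lparr>carrier := ?S\<rparr>)"
    then show "\<phi> g x = x" using fix_x by simp
  next
    fix y assume "y \<in> ?F" "y \<noteq> x" "\<And>g. g \<in> carrier (G\<lparr>carrier := ?S\<rparr>) \<Longrightarrow> \<phi> g y = y"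
    then show thesis using that by simp
  qed
  obtain g where g: "g \<in> carrier G" "y = \<phi> g x" using y(1) by (auto simp: orbit_def)
  have "inv g \<otimes> c \<otimes> g \<in> ?S" if c: "c \<in> ?S" for c
  proof -
    have c': "c \<in> carrier G" using c by (rule S.mem_carrier)
    have "\<phi> (inv g \<otimes> c \<otimes> g) x = \<phi> (inv g) (\<phi> c (\<phi> g x))"
      using composition_rule[OF x(1), of "inv g \<otimes> c" g]
        composition_rule[of "\<phi> g x" "inv g" c] element_image[OF g(1) x(1)] g c' by simp
    also have "\<dots> = \<phi> (inv g) (\<phi> g x)" using y(3)[OF c] g(2) by simp
    also have "\<dots> = \<phi> (inv g \<otimes> g) x" using composition_rule[OF x(1), of "inv g" g] g by simp
    also have "\<dots> = x" using fix_x[OF S.one_closed] g(1) by simp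
    finally show ?thesis
      using g c' unfolding stabilizer_def by (intro CollectI conjI) simp_all
  qed
  then show ?thesis using that g y(2) by blast
qed

text \<open>
  The normalizer of \<open>C\<close> is its stabilizer under conjugation of subsets. If it were \<open>C\<close> itself, the
  previous lemma would give an element outside \<open>C\<close> that normalizes \<open>C\<close>.
\<close>

lemma (in group) normalizer_greater:
  assumes fin: "finite (carrier G)" and p: "prime (p :: nat)" "order G = p ^ m"
    and C: "subgroup C G" "C \<noteq> carrier G"
  shows "C \<subset> normalizer G C"
proof -
  interpret C: subgroup C G by fact
  define \<phi> where "\<phi> = (\<lambda>g. \<lambda>H \<in> {H. H \<subseteq> carrier G}. g <# H #> inv g)"
  interpret act: group_action G "{H. H \<subseteq> carrier G}" \<phi>
    unfolding \<phi>_def by (rule action_by_conjugation_on_power_set)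
  have CE: "C \<in> {H. H \<subseteq> carrier G}" using C.subset by simp
  have \<phi>_eq: "\<phi> g C = (\<lambda>c. g \<otimes> c \<otimes> inv g) ` C" for g
    using C.subset by (simp add: \<phi>_def conj_coset_image)
  have norm: "normalizer G C = stabilizer G \<phi> C" by (simp add: normalizer_def \<phi>_def)
  have "C \<subseteq> normalizer G C"
  proof
    fix x assume x: "x \<in> C"
    have "c \<in> \<phi> x C" if c: "c \<in> C" for c
      unfolding \<phi>_eq using conj_inverse_cancel[of x c, symmetric] x c
      by (intro image_eqI[of _ _ "inv x \<otimes> c \<otimes> x"]) (auto simp: C.mem_carrier)
    moreover have "\<phi> x C \<subseteq> C" using x by (auto simp: \<phi>_eq)
    ultimately show "x \<in> normalizer G C" using x by (auto simp: norm stabilizer_def C.mem_carrier)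
  qed
  moreover have "C \<noteq> normalizer G C"
  proof
    assume eq: "C = normalizer G C"
    have "orbit G \<phi> C \<noteq> {C}"
    proof
      assume "orbit G \<phi> C = {C}"
      then have "stabilizer G \<phi> C = carrier G" unfolding orbit_def stabilizer_def by blast
      then show False using C eq norm by simp
    qed
    then obtain g where g: "g \<in> carrier G" "\<phi> g C \<noteq> C" "\<And>c. c \<in> C \<Longrightarrow> inv g \<otimes> c \<otimes> g \<in> C"
      using act.p_group_stabilizer_conjugate[OF fin p CE] norm eq by metis
    have "C \<subseteq> \<phi> g C"
    proof
      fix c assume c: "c \<in> C"
      have "g \<otimes> (inv g \<otimes> c \<otimes> g) \<otimes> inv g = c"
        using c g(1) by (simp add: conj_inverse_cancel C.mem_carrier)
      then show "c \<in> \<phi> g C" unfolding \<phi>_eq by (rule image_eqI[OF sym]) (rule g(3)[OF c])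
    qed
    moreover have "card (\<phi> g C) = card C"
      unfolding \<phi>_eq by (rule card_image) (rule inj_onI, use g(1) in \<open>simp add: C.mem_carrier\<close>)
    moreover have "finite (\<phi> g C)" using finite_subset[OF C.subset fin] by (simp add: \<phi>_eq)
    ultimately show False using g(2) by (metis card_subset_eq)
  qed
  ultimately show ?thesis by blast
qed

context fin_group
begin

lemma span_commutes:
  assumes "C \<subseteq> carrier G" "z \<in> span (T ` C)" "\<And>c. c \<in> C \<Longrightarrow> conj_by c y = y"
  shows "z * y = y * z"
  using assms(2)
proof (induction rule: span_induct_alt)
  case (step r t b)
  then obtain d where d: "d \<in> C" "t = T d" by auto
  then have "T d * y = y * T d" using conj_eq_iff[of d y] assms(1) assms(3)[of d] by auto
  then show ?case using step d by (simp add: algebra_simps)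
qed simp

lemma conj_in_span:
  assumes "C \<subseteq> carrier G" "z \<in> span (T ` C)" "x \<in> carrier G"
    and C: "\<And>c. c \<in> C \<Longrightarrow> x \<otimes> c \<otimes> inv x \<in> C"
  shows "conj_by x z \<in> span (T ` C)"
  using assms(2)
proof (induction rule: span_induct_alt)
  case base
  then show ?case by (simp add: conj_by_def span_zero)
next
  case (step r t b)
  then obtain d where d: "d \<in> C" "t = T d" by auto
  then have "conj_by x t = T (x \<otimes> d \<otimes> inv x)" using assms(1,3) by (auto simp: conj_T)
  then have "conj_by x t \<in> span (T ` C)" using C[OF d(1)] by (simp add: span_base)
  then show ?case using step by (simp add: conj_linear span_add span_scale)
qed

text \<open>
  An element of the center of the group algebra of \<open>C\<close> commutes with its conjugates by elements
  normalizing \<open>C\<close>. So the exponential of the sum of these conjugates is a product of conjugates of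
  \<open>exp y\<close>, and stays integral.
\<close>

lemma exp_sum_conj_integral:
  assumes C: "subgroup C G" and y: "y \<in> span (T ` C)" "\<And>c. c \<in> C \<Longrightarrow> conj_by c y = y"
    and exp: "exp y \<in> int_group_alg"
    and F: "finite F" "F \<subseteq> carrier G" "\<And>x c. x \<in> F \<Longrightarrow> c \<in> C \<Longrightarrow> inv x \<otimes> c \<otimes> x \<in> C" 
      "\<And>x c. x \<in> F \<Longrightarrow> c \<in> C \<Longrightarrow> x \<otimes> c \<otimes> inv x \<in> C"
  shows "exp (\<Sum>x\<in>F. conj_by x y) \<in> int_group_alg"
  using F
proof (induction F rule: finite_induct)
  case empty
  then show ?case by simp
next
  case (insert x F)
  interpret C: subgroup C G by fact
  have "conj_by x y * conj_by z y = conj_by z y * conj_by x y" if z: "z \<in> F" for z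
  proof -
    have x: "x \<in> carrier G" and zc: "z \<in> carrier G" using insert.prems(1) z by auto
    have "conj_by z y \<in> span (T ` C)"
      by (rule conj_in_span[OF C.subset y(1) zc]) (rule insert.prems(3), use z in simp_all)
    then have "conj_by (inv x) (conj_by z y) \<in> span (T ` C)"
      by (rule conj_in_span[OF C.subset _ inv_closed[OF x]]) (use insert.prems(2)[of x] x in simp)
    from span_commutes[OF C.subset this y(2)] have "conj_by x (conj_by (inv x) (conj_by z y) * y) = conj_by x (y * conj_by (inv x) (conj_by z y))"
      by simp
    then show ?thesis using x zc by (simp add: conj_mult conj_conj flip: m_assoc)
  qed
  then have "conj_by x y * (\<Sum>z\<in>F. conj_by z y) = (\<Sum>z\<in>F. conj_by z y) * conj_by x y"
    by (simp add: sum_distrib_left sum_distrib_right)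
  then have "exp (\<Sum>z\<in>insert x F. conj_by z y) = exp (conj_by x y) * exp (\<Sum>z\<in>F. conj_by z y)"
    using insert.hyps by (simp add: exp_add_commuting)
  moreover have "exp (conj_by x y) = conj_by x (exp y)" using insert.prems by (simp add: exp_conj)
  ultimately show ?case using insert exp by simp
qed

text \<open>
  Summing the conjugates of \<open>y\<close> over the normalizer \<open>N\<close> of \<open>C\<close> gives an element that is central for
  \<open>N\<close> and still has integral exponential. Since normalizers grow in a p-group, finitely many such
  steps reach \<open>G\<close>. Each step repeats every conjugate \<open>card N\<close> times, which is where the multiple \<open>k\<close>
  comes from.
\<close>

lemma exp_trace_integral:
  assumes p: "prime (p :: nat)" "order G = p ^ m"
    and "subgroup C G" "y \<in> span (T ` C)" "\<And>c. c \<in> C \<Longrightarrow> conj_by c y = y"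
    and "exp y \<in> int_group_alg" "exp (- y) \<in> int_group_alg"
  obtains k :: nat where "k > 0" 
    "exp (real k *\<^sub>R (\<Sum>x\<in>carrier G. conj_by x y)) \<in> int_group_alg"
    "exp (- (real k *\<^sub>R (\<Sum>x\<in>carrier G. conj_by x y))) \<in> int_group_alg"
proof -
  have "\<exists>k>0. exp (real k *\<^sub>R (\<Sum>x\<in>carrier G. conj_by x y)) \<in> int_group_alg \<and>
    exp (- (real k *\<^sub>R (\<Sum>x\<in>carrier G. conj_by x y))) \<in> int_group_alg"
    using assms(3-)
  proof (induction "order G - card C" arbitrary: C y rule: less_induct)
    case less
    interpret C: subgroup C G by fact
    let ?N = "normalizer G C"
    interpret N: subgroup ?N G by (rule normalizer_imp_subgroup) (rule C.subset)
    define y' where "y' = (\<Sum>x\<in>?N. conj_by x y)"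
    have finN: "finite ?N" using fin N.subset finite_subset by blast
    have normC: "inv x \<otimes> c \<otimes> x \<in> C" "x \<otimes> c \<otimes> inv x \<in> C" if "x \<in> ?N" "c \<in> C" for x c
      using set_conj_normalizer[OF less.prems(1), of x c] 
        set_conj_normalizer[OF less.prems(1), of "inv x" c] that by (simp_all add: N.mem_carrier)
    have "exp y' \<in> int_group_alg" unfolding y'_def
      by (rule exp_sum_conj_integral[OF less.prems(1-4) finN N.subset normC])
    moreover have "exp (- y') \<in> int_group_alg"
      using exp_sum_conj_integral[OF less.prems(1) span_neg[OF less.prems(2)] _ less.prems(5) finN N.subset normC]
        less.prems(3) 
      by (simp add: y'_def conj_linear sum_negf)
    ultimately have y': "exp y' \<in> int_group_alg" "exp (- y') \<in> int_group_alg" .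
    show ?case
    proof (cases "C = carrier G")
      case True
      have "exp (\<Sum>x\<in>carrier G. conj_by x y) \<in> int_group_alg"
        by (rule exp_sum_conj_integral[OF less.prems(1-4) fin]) (auto simp: True)
      moreover have "exp (\<Sum>x\<in>carrier G. conj_by x (- y)) \<in> int_group_alg"
        by (rule exp_sum_conj_integral[OF less.prems(1) span_neg[OF less.prems(2)] _ less.prems(5) fin])
          (use less.prems(3) in \<open>auto simp: True conj_linear\<close>)
      ultimately show ?thesis by (intro exI[of _ 1]) (simp add: conj_linear sum_negf)
    next
      case False
      have "C \<subset> ?N" by (rule normalizer_greater[OF fin p less.prems(1) False])
      then have "card C < card ?N" using finN psubset_card_mono by blast
      moreover have "card ?N \<le> order G" using fin N.subset by (simp add: Coset.order_def card_mono)
      ultimately have lt: "order G - card ?N < order G - card C" by simp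
      have "y \<in> span (T ` ?N)"
        using less.prems(2) \<open>C \<subset> ?N\<close> span_mono[of "T ` C" "T ` ?N"] by auto
      have "y' \<in> span (T ` ?N)"
        unfolding y'_def
      proof (intro span_sum)
        fix x assume x: "x \<in> ?N"
        show "conj_by x y \<in> span (T ` ?N)"
          by (rule conj_in_span[OF N.subset \<open>y \<in> span (T ` ?N)\<close>])
            (use x in \<open>simp_all add: N.mem_carrier\<close>)
      qed
      moreover have "conj_by c y' = y'" if c: "c \<in> ?N" for c
      proof -
        have "conj_by c y' = (\<Sum>x\<in>?N. conj_by (c \<otimes> x) y)"
          using c by (simp add: y'_def conj_linear conj_conj N.mem_carrier)
        also have "\<dots> = y'" unfolding y'_def
          by (rule sum.reindex_bij_witness[of _ "\<lambda>x. inv c \<otimes> x" "\<lambda>x. c \<otimes> x"])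
            (use c in \<open>auto simp: N.mem_carrier simp flip: m_assoc\<close>)
        finally show ?thesis .
      qed
      ultimately obtain k where k: "k > 0" 
        "exp (real k *\<^sub>R (\<Sum>x\<in>carrier G. conj_by x y')) \<in> int_group_alg"
        "exp (- (real k *\<^sub>R (\<Sum>x\<in>carrier G. conj_by x y'))) \<in> int_group_alg"
        using less.hyps[OF lt N.subgroup_axioms _ _ y'] by auto
      have "(\<Sum>x\<in>carrier G. conj_by x y') = (\<Sum>x\<in>carrier G. \<Sum>z\<in>?N. conj_by (x \<otimes> z) y)"
        by (simp add: y'_def conj_linear conj_conj N.mem_carrier)
      also have "\<dots> = (\<Sum>z\<in>?N. \<Sum>x\<in>carrier G. conj_by (x \<otimes> z) y)" by (rule sum.swap)
      also have "\<dots> = (\<Sum>z\<in>?N. \<Sum>x\<in>carrier G. conj_by x y)"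
      proof (rule sum.cong[OF refl])
        fix z assume "z \<in> ?N"
        then have z: "z \<in> carrier G" by (rule N.mem_carrier)
        show "(\<Sum>x\<in>carrier G. conj_by (x \<otimes> z) y) = (\<Sum>x\<in>carrier G. conj_by x y)"
          by (rule sum.reindex_bij_witness[of _ "\<lambda>x. x \<otimes> inv z" "\<lambda>x. x \<otimes> z"])
            (use z in \<open>auto simp: m_assoc\<close>)
      qed
      also have "\<dots> = real (card ?N) *\<^sub>R (\<Sum>x\<in>carrier G. conj_by x y)" by (simp add: scaleR_conv_of_real)
      finally have "real k *\<^sub>R (\<Sum>x\<in>carrier G. conj_by x y') = real (k * card ?N) *\<^sub>R (\<Sum>x\<in>carrier G. conj_by x y)"
        by simp
      moreover have "k * card ?N > 0" using k \<open>card C < card ?N\<close> by simp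
      ultimately show ?thesis using k by metis
    qed
  qed
  then show ?thesis using that by blast
qed

end

section \<open>The logarithm of 1 + a for an element of finite odd order\<close>

lemma exp_commutes:
  fixes a y :: "'b :: {real_normed_algebra_1,banach}"
  assumes "a * y = y * a"
  shows "a * exp y = exp y * a"
proof -
  have "a * y ^ n = y ^ n * a" for n
  proof (induction n)
    case (Suc n)
    have "a * y ^ Suc n = y * (a * y ^ n)" by (simp add: assms flip: mult.assoc)
    then show ?case using Suc by (simp add: mult.assoc)
  qed simp
  then have "(\<lambda>n. a * (y ^ n /\<^sub>R fact n)) = (\<lambda>n. (y ^ n /\<^sub>R fact n) * a)" by simp
  moreover have "(\<lambda>n. a * (y ^ n /\<^sub>R fact n)) sums (a * exp y)"
    by (intro bounded_linear.sums[OF bounded_linear_mult_right] exp_converges)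
  moreover have "(\<lambda>n. (y ^ n /\<^sub>R fact n) * a) sums (exp y * a)"
    by (intro bounded_linear.sums[OF bounded_linear_mult_left] exp_converges)
  ultimately show ?thesis by (metis sums_unique2)
qed

lemma has_vector_derivative_exp_sum:
  fixes a :: "'i \<Rightarrow> 'b :: {real_normed_algebra_1,banach}"
  assumes "finite F" "\<And>k. k \<in> F \<Longrightarrow> (c k has_vector_derivative d k) (at s within S)"
    and comm: "\<And>i j. a i * a j = a j * a i"
  shows "((\<lambda>s. exp (\<Sum>k\<in>F. c k s *\<^sub>R a k)) has_vector_derivative
    exp (\<Sum>k\<in>F. c k s *\<^sub>R a k) * (\<Sum>k\<in>F. d k *\<^sub>R a k)) (at s within S)"
  using assms(1,2)
proof (induction F rule: finite_induct)
  case empty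
  then show ?case by simp
next
  case (insert k F)
  let ?f = "\<lambda>s. \<Sum>k\<in>F. c k s *\<^sub>R a k"
  have comm_sum: "a k * ?f s = ?f s * a k" for s
    by (simp add: sum_distrib_left sum_distrib_right comm)
  have 1: "((\<lambda>s. exp (c k s *\<^sub>R a k)) has_vector_derivative
      d k *\<^sub>R (exp (c k s *\<^sub>R a k) * a k)) (at s within S)"
    using vector_diff_chain_within[OF insert.prems[of k, simplified] 
        exp_scaleR_has_vector_derivative_right[of "a k" "c k s" "c k ` S"]] by (simp add: o_def)
  have "((\<lambda>s. exp (c k s *\<^sub>R a k) * exp (?f s)) has_vector_derivative
      exp (c k s *\<^sub>R a k) * (exp (?f s) * (\<Sum>k\<in>F. d k *\<^sub>R a k)) +
      (d k *\<^sub>R (exp (c k s *\<^sub>R a k) * a k)) * exp (?f s)) (at s within S)"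
    by (intro has_vector_derivative_mult 1 insert.IH) (use insert.prems in auto)
  moreover have "exp (c k s *\<^sub>R a k) * exp (?f s) = exp (\<Sum>k\<in>insert k F. c k s *\<^sub>R a k)" for s
    using insert.hyps comm_sum[of s] by (simp add: exp_add_commuting)
  moreover have "exp (c k s *\<^sub>R a k) * (exp (?f s) * (\<Sum>k\<in>F. d k *\<^sub>R a k)) +
      (d k *\<^sub>R (exp (c k s *\<^sub>R a k) * a k)) * exp (?f s) =
      exp (c k s *\<^sub>R a k) * exp (?f s) * (\<Sum>k\<in>insert k F. d k *\<^sub>R a k)"
    using insert.hyps exp_commutes[OF comm_sum[of s]] by (simp add: algebra_simps)
  ultimately show ?case by simp
qed

lemma geometric_sum_mult: "(\<Sum>k<n. x ^ k) * (1 - x) = 1 - x ^ n"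
  for x :: "'b :: ring_1"
proof (induction n)
  case (Suc n)
  have "(\<Sum>k<Suc n. x ^ k) * (1 - x) = (\<Sum>k<n. x ^ k) * (1 - x) + (x ^ n - x ^ Suc n)"
    by (simp add: distrib_right right_diff_distrib power_commutes)
  then show ?case using Suc by simp
qed simp

text \<open>
  If \<open>a ^ n = 1\<close> with \<open>n\<close> odd, then \<open>a * inverse (1 + t * a)\<close> is the sum over \<open>k = 1, \<dots>, n\<close> of
  \<open>(- 1) ^ (k - 1) * t ^ (k - 1) / (1 + t ^ n)\<close> times \<open>a ^ k\<close>, by the geometric sum. Integration over
  \<open>{0..s}\<close> gives the coefficients of a logarithm of \<open>1 + s * a\<close>.
\<close>

definition log1p_coeff :: "nat \<Rightarrow> nat \<Rightarrow> real \<Rightarrow> real" where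
  "log1p_coeff n k s = integral {0..s} (\<lambda>t. (- 1) ^ (k - 1) * t ^ (k - 1) / (1 + t ^ n))"

lemma log1p_coeff_continuous:
  "continuous_on {0..s} (\<lambda>t :: real. (- 1) ^ (k - 1) * t ^ (k - 1) / (1 + t ^ n))"
proof -
  have "1 + t ^ n \<noteq> 0" if "t \<in> {0..s}" for t :: real
    using that by (simp add: add_nonneg_eq_0_iff)
  then show ?thesis by (intro continuous_intros) auto
qed

lemma log1p_coeff_deriv:
  assumes "s \<in> {0..1}"
  shows "(log1p_coeff n k has_vector_derivative (- 1) ^ (k - 1) * s ^ (k - 1) / (1 + s ^ n)) (at s within {0..1})"
  unfolding log1p_coeff_def
  using integral_has_vector_derivative[OF log1p_coeff_continuous assms] .

text \<open>
  For the candidate logarithm \<open>L s\<close>, the function \<open>exp (- L s) * (1 + s * a)\<close> has derivative 0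
  on the unit interval and value 1 at 0.
\<close>

lemma exp_log1p:
  fixes a :: "'b :: {real_normed_algebra_1,banach}"
  assumes n: "odd n" and a: "a ^ n = 1"
  shows "exp (\<Sum>k\<in>{1..n}. log1p_coeff n k 1 *\<^sub>R a ^ k) = 1 + a"
proof -
  define L where "L s = (\<Sum>k\<in>{1..n}. log1p_coeff n k s *\<^sub>R a ^ k)" for s
  define D where "D s = (\<Sum>k\<in>{1..n}. ((- 1) ^ (k - 1) * s ^ (k - 1) / (1 + s ^ n)) *\<^sub>R a ^ k)" for s
  have comm: "a * (\<Sum>k\<in>{1..n}. f k *\<^sub>R a ^ k) = (\<Sum>k\<in>{1..n}. f k *\<^sub>R a ^ k) * a" for f
    by (simp add: sum_distrib_left sum_distrib_right power_commutes)
  have D: "D s * (1 + s *\<^sub>R a) = a" if s: "s \<in> {0..1}" for s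
  proof -
    have nz: "1 + s ^ n \<noteq> 0" using s by (simp add: add_nonneg_eq_0_iff)
    have "D s = (\<Sum>k<n. ((- 1) ^ k * s ^ k / (1 + s ^ n)) *\<^sub>R a ^ Suc k)"
      unfolding D_def by (rule sum.reindex_bij_witness[of _ Suc "\<lambda>k. k - 1"]) auto
    also have "\<dots> = (1 / (1 + s ^ n)) *\<^sub>R (a * (\<Sum>k<n. (- s *\<^sub>R a) ^ k))"
      by (simp add: scaleR_sum_right sum_distrib_left scaleR_power power_minus[of s]
          del: scaleR_minus_left)
    finally have D: "D s = (1 / (1 + s ^ n)) *\<^sub>R (a * (\<Sum>k<n. (- s *\<^sub>R a) ^ k))" .
    have "(\<Sum>k<n. (- s *\<^sub>R a) ^ k) * (1 + s *\<^sub>R a) = 1 - (- s *\<^sub>R a) ^ n"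
      using geometric_sum_mult[of "- s *\<^sub>R a" n] by simp
    also have "\<dots> = (1 + s ^ n) *\<^sub>R 1" using n a by (simp add: scaleR_left.add scaleR_power flip: scaleR_minus_left)
    finally show ?thesis unfolding D using nz by (simp add: mult.assoc)
  qed
  have L: "((\<lambda>s. exp (- L s)) has_vector_derivative exp (- L s) * (- D s)) (at s within {0..1})"
    if "s \<in> {0..1}" for s
    using has_vector_derivative_exp_sum[of "{1..n}" "\<lambda>k s. - log1p_coeff n k s" 
        "\<lambda>k. - ((- 1) ^ (k - 1) * s ^ (k - 1) / (1 + s ^ n))" s "{0..1}" "\<lambda>k. a ^ k"]
      has_vector_derivative_minus[OF log1p_coeff_deriv[OF that]]
    by (simp add: L_def D_def sum_negf power_add[symmetric] add.commute)
  have "((\<lambda>s. exp (- L s) * (1 + s *\<^sub>R a)) has_vector_derivative 0) (at s within {0..1})"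
    if s: "s \<in> {0..1}" for s
  proof -
    have "((\<lambda>s. exp (- L s) * (1 + s *\<^sub>R a)) has_vector_derivative
      exp (- L s) * a + exp (- L s) * (- D s) * (1 + s *\<^sub>R a)) (at s within {0..1})"
      by (rule has_vector_derivative_mult[OF L[OF s]]) (auto intro!: derivative_eq_intros)
    then show ?thesis using D[OF s] by (simp add: mult.assoc)
  qed
  then obtain c where "\<forall>s\<in>{0..1}. exp (- L s) * (1 + s *\<^sub>R a) = c"
    using has_vector_derivative_zero_constant[of "{0..1::real}" "\<lambda>s. exp (- L s) * (1 + s *\<^sub>R a)"] by fastforce
  then have "exp (- L 1) * (1 + 1 *\<^sub>R a) = exp (- L 0) * (1 + 0 *\<^sub>R a)" 
    by (metis atLeastAtMost_iff order_refl zero_le_one)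
  also have "L 0 = 0" by (simp add: L_def log1p_coeff_def)
  finally have "exp (- L 1) * (1 + a) = 1" by simp
  then have "exp (L 1) * (exp (- L 1) * (1 + a)) = exp (L 1)" by simp
  then show ?thesis unfolding L_def[symmetric] by (simp flip: mult.assoc add: exp_minus_inverse)
qed

section \<open>Congruences modulo powers of 3 and a definite integral\<close>

lemma pow_three_power_expansion:
  fixes k :: int
  assumes "k mod 9 \<in> {4, 7}"
  shows "\<exists>u. k ^ (3 ^ e) = 1 + 3 ^ Suc e * u \<and> \<not> 3 dvd u"
proof (induction e)
  case 0
  have "k mod 9 = 4 \<or> k mod 9 = 7" using assms by auto
  then have "k = 1 + 3 * (3 * (k div 9) + 1) \<or> k = 1 + 3 * (3 * (k div 9) + 2)"
    by presburger
  moreover have "\<not> 3 dvd (3 * m + 1 :: int)" "\<not> 3 dvd (3 * m + 2 :: int)" for m by presburger+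
  ultimately show ?case by (metis power_0 power_one_right power_Suc0_right)
next
  case (Suc e)
  then obtain u where u: "k ^ (3 ^ e) = 1 + 3 ^ Suc e * u" "\<not> 3 dvd u" by auto
  let ?v = "u + 3 * (3 ^ e * u\<^sup>2 + 3 ^ e * 3 ^ e * u ^ 3)"
  have "k ^ (3 ^ Suc e) = (k ^ (3 ^ e)) ^ 3" by (simp add: power_mult[symmetric] mult.commute)
  also have "\<dots> = 1 + 3 ^ Suc (Suc e) * ?v"
    by (simp add: u power3_eq_cube power2_eq_square algebra_simps)
  finally show ?case using u(2) by (intro exI[of _ ?v]) (auto simp: dvd_add_left_iff)
qed

text \<open>
  Residues 4 and 7 modulo 9 are those that are 1 modulo 3 but not modulo 9; they generate the group
  of residues congruent to 1 modulo 3. A solution modulo \<open>3 ^ e\<close> is lifted by multiplying with a power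
  of \<open>k ^ 3 ^ (e - 1)\<close>, which is 1 modulo \<open>3 ^ e\<close> but not modulo \<open>3 ^ Suc e\<close>.
\<close>

lemma pow_surj_mod_three_power:
  fixes k a :: int
  assumes k: "k mod 9 \<in> {4, 7}" and a: "a mod 3 = 1"
  shows "\<exists>i. [k ^ i = a] (mod 3 ^ e)"
proof (induction e)
  case 0
  show ?case by (intro exI[of _ 0]) (simp add: cong_def)
next
  case (Suc e)
  show ?case
  proof (cases e)
    case 0
    then show ?thesis using a by (intro exI[of _ 0]) (simp add: cong_def)
  next
    case (Suc d)
    obtain i where "[k ^ i = a] (mod 3 ^ e)" using Suc.IH by auto
    then obtain w where w: "a = k ^ i + 3 ^ e * w" by (auto simp: cong_iff_lin)
    obtain u where u: "k ^ (3 ^ d) = 1 + 3 ^ e * u" "\<not> 3 dvd u"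
      using pow_three_power_expansion[OF k, of d] Suc by auto
    have "k mod 9 = 4 \<or> k mod 9 = 7" using k by auto
    then have k3: "k mod 3 = 1" by presburger
    have "prime (3 :: int)" by simp
    then have "coprime u 3" using u(2) prime_imp_coprime coprime_commute by blast
    then obtain r where r: "[u * r = w] (mod 3)" using cong_solve_coprime_int[of u 3] 
      by (metis cong_scalar_right mult.assoc mult_1)
    define s where "s = nat (r mod 3)"
    have s: "[u * int s = w] (mod 3)" using r by (simp add: s_def cong_def mod_mult_right_eq)
    have "[k ^ (3 ^ d * s) = 1 + 3 ^ e * (u * int s)] (mod 3 ^ Suc e)"
    proof (induction s)
      case (Suc s)
      have "[k ^ (3 ^ d * s) * k ^ (3 ^ d) = (1 + 3 ^ e * (u * int s)) * (1 + 3 ^ e * u)] (mod 3 ^ Suc e)"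
        unfolding u(1) by (intro cong_mult Suc.IH cong_refl)
      also have "(1 + 3 ^ e * (u * int s)) * (1 + 3 ^ e * u) =
        (1 + 3 ^ e * (u * int (Suc s))) + 3 ^ Suc e * (3 ^ d * u * u * int s)"
        by (simp add: \<open>e = Suc d\<close> algebra_simps)
      also have "[\<dots> = 1 + 3 ^ e * (u * int (Suc s))] (mod 3 ^ Suc e)"
        by (simp add: cong_def)
      finally show ?case by (simp add: power_add algebra_simps)
    qed simp
    then have "[k ^ i * k ^ (3 ^ d * s) = k ^ i * (1 + 3 ^ e * (u * int s))] (mod 3 ^ Suc e)"
      by (rule cong_scalar_left)
    also have "[k ^ i * (1 + 3 ^ e * (u * int s)) = k ^ i + 3 ^ e * w] (mod 3 ^ Suc e)"
    proof -
      have "[k ^ i = 1] (mod 3)" using cong_pow[of k 1 3 i] k3 by (simp add: cong_def)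
      then have "[k ^ i * (u * int s) = 1 * w] (mod 3)" using s by (rule cong_mult)
      then obtain t where "k ^ i * (u * int s) = w + 3 * t" 
        by (metis cong_iff_lin cong_sym mult_1)
      then have "k ^ i + 3 ^ e * (k ^ i * (u * int s)) = k ^ i + 3 ^ e * (w + 3 * t)" by simp
      then have "k ^ i * (1 + 3 ^ e * (u * int s)) = k ^ i + 3 ^ e * w + 3 ^ Suc e * t"
        by (simp add: algebra_simps)
      then show ?thesis by (simp add: cong_def)
    qed
    finally show ?thesis unfolding w by (metis power_add)
  qed
qed

lemma sum_two_classes_mod_9:
  fixes h :: "nat \<Rightarrow> real"
  assumes n: "n = 9 * q" and ab: "a < b" "b < 9"
  shows "(\<Sum>j\<in>{j. j < n \<and> j mod 9 \<in> {a, b}}. h j) = (\<Sum>i<q. h (9 * i + a) + h (9 * i + b))"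
  proof -
    have "{j. j < n \<and> j mod 9 \<in> {a, b}} = (\<lambda>i. 9 * i + a) ` {..<q} \<union> (\<lambda>i. 9 * i + b) ` {..<q}"
      (is "?J = ?A \<union> ?B")
    proof (rule equalityI; rule subsetI)
      fix j assume j: "j \<in> ?J"
      then have "j div 9 < q" using n by auto
      moreover have "j = 9 * (j div 9) + a \<or> j = 9 * (j div 9) + b"
        using j by (metis (no_types, lifting) insert_iff mem_Collect_eq mult_div_mod_eq singletonD)
      ultimately show "j \<in> ?A \<union> ?B" by blast
    next
      fix j assume "j \<in> ?A \<union> ?B"
      then obtain i where "i < q" "j = 9 * i + a \<or> j = 9 * i + b" by auto
      moreover from this have "j < n" using ab n by presburger
      moreover have "(9 * i + a) mod 9 = a" "(9 * i + b) mod 9 = b" using ab by simp_all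
      ultimately show "j \<in> ?J" by auto
    qed
    moreover have "(\<lambda>i. 9 * i + a) ` {..<q} \<inter> (\<lambda>i. 9 * i + b) ` {..<q} = {}"
    proof -
      have "9 * i + a \<noteq> 9 * i' + b" for i i' using ab by presburger
      then show ?thesis by blast
    qed
    ultimately show ?thesis
      by (simp add: sum.union_disjoint sum.reindex inj_on_def sum.distrib)
  qed

text \<open>
  Grouping the exponents by their quotient modulo 9 turns each sum into a geometric sum in
  \<open>- (t ^ 9)\<close>, which cancels the denominator \<open>1 + t ^ n\<close> down to \<open>1 + t ^ 9\<close>. The difference of the
  integrands is then \<open>(1 + t) * (1 - t ^ 6) / (1 + t ^ 9)\<close>, which is nonnegative and equals 1 at \<open>t = 0\<close>.
\<close>

lemma integral_log1p_difference:
  fixes q :: nat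
  assumes q: "odd q" and n: "n = 9 * q"
  shows "(\<Sum>j\<in>{j. j < n \<and> j mod 9 \<in> {1, 8}}. log1p_coeff n j 1) \<noteq>
    (\<Sum>j\<in>{j. j < n \<and> j mod 9 \<in> {2, 7}}. log1p_coeff n j 1)"
proof -
  define f where "f j t = (- 1) ^ (j - 1) * t ^ (j - 1) / (1 + t ^ n)" for j and t :: real
  let ?g = "\<lambda>t :: real. (1 + t) * (1 - t ^ 6) / (1 + t ^ 9)"
  have f_cont: "continuous_on {0..1} (f j)" for j
    unfolding f_def by (rule log1p_coeff_continuous)
  have eq: "(\<Sum>i<q. f (9 * i + 1) t + f (9 * i + 8) t) - (\<Sum>i<q. f (9 * i + 2) t + f (9 * i + 7) t) = ?g t"
    if t: "t \<in> {0..1}" for t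
  proof -
    have "(\<Sum>i<q. f (9 * i + 1) t + f (9 * i + 8) t) - (\<Sum>i<q. f (9 * i + 2) t + f (9 * i + 7) t) =
      (\<Sum>i<q. (- (t ^ 9)) ^ i * ((1 + t) * (1 - t ^ 6)) / (1 + t ^ n))"
      unfolding sum_subtractf[symmetric]
    proof (rule sum.cong[OF refl])
      fix i
      have f: "f (9 * i + Suc a) t = (- 1) ^ a * t ^ a * (- (t ^ 9)) ^ i / (1 + t ^ n)" for a
        by (simp add: f_def power_add power_mult power_minus[of "t ^ 9"])
      show "f (9 * i + 1) t + f (9 * i + 8) t - (f (9 * i + 2) t + f (9 * i + 7) t) =
        (- (t ^ 9)) ^ i * ((1 + t) * (1 - t ^ 6)) / (1 + t ^ n)"
        using f[of 0] f[of 7] f[of 1] f[of 6] power_Suc[of t 6]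
        by (simp add: algebra_simps diff_divide_distrib add_divide_distrib del: mult_minus_left power_minus_odd)
    qed
    also have "\<dots> = (\<Sum>i<q. (- (t ^ 9)) ^ i) * ((1 + t) * (1 - t ^ 6)) / (1 + t ^ n)"
      by (simp add: sum_distrib_right sum_divide_distrib)
    also have "(\<Sum>i<q. (- (t ^ 9)) ^ i) * (1 + t ^ 9) = 1 + t ^ n"
      using geometric_sum_mult[of "- (t ^ 9)" q] q by (simp add: n power_mult)
    then have "(\<Sum>i<q. (- (t ^ 9)) ^ i) = (1 + t ^ n) / (1 + t ^ 9)"
      using t by (simp add: eq_divide_eq add_nonneg_eq_0_iff)
    finally show ?thesis using t by (simp add: add_nonneg_eq_0_iff)
  qed
  have "(\<Sum>j\<in>{j. j < n \<and> j mod 9 \<in> {1, 8}}. log1p_coeff n j 1) -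
      (\<Sum>j\<in>{j. j < n \<and> j mod 9 \<in> {2, 7}}. log1p_coeff n j 1) = 
    integral {0..1} (\<lambda>t. (\<Sum>i<q. f (9 * i + 1) t + f (9 * i + 8) t) - (\<Sum>i<q. f (9 * i + 2) t + f (9 * i + 7) t))"
    unfolding log1p_coeff_def f_def[symmetric] 
    by (subst (1 2) sum_two_classes_mod_9[OF n]) (simp_all add: integral_diff integral_sum integral_add 
          integrable_sum integrable_add integrable_continuous_real f_cont)
  also have "\<dots> = integral {0..1} ?g" by (rule integral_cong) (rule eq)
  also have "\<dots> \<noteq> 0"
  proof -
    have "continuous_on {0..1} ?g"
      by (intro continuous_intros) (auto simp: add_nonneg_eq_0_iff)
    moreover have "?g t \<ge> 0" if "t \<in> {0..1}" for t using that by (auto simp: power_le_one)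
    ultimately have "integral {0..1} ?g = 0 \<longleftrightarrow> (\<forall>t\<in>{0..1}. ?g t = 0)"
      by (intro integral_eq_0_iff) auto
    then show ?thesis by (metis (no_types) atLeastAtMost_iff add.right_neutral div_by_1 diff_zero mult_1 order_refl power_0_left zero_le_one zero_neq_numeral zero_neq_one)
  qed
  finally show ?thesis by simp
qed

section \<open>Trivial central units force g^2 to be conjugate to the inverse of g\<close>

context group
begin

lemma pow_mult_one:
  assumes "a \<in> carrier G" "a [^] (n :: nat) = \<one>"
  shows "a [^] (n * k :: nat) = \<one>" "a [^] (k * n :: nat) = \<one>"
proof -
  have "(a [^] n) [^] k = a [^] (n * k)" using assms(1) by (rule nat_pow_pow)
  then show "a [^] (n * k) = \<one>" using assms(2) by simp
  then show "a [^] (k * n) = \<one>" by (simp add: mult.commute)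
qed

lemma pow_cong:
  assumes a: "a \<in> carrier G" "a [^] (n :: nat) = \<one>" and ij: "[i = j] (mod n)"
  shows "a [^] i = a [^] j"
proof -
  have "a [^] i = a [^] (i mod n)" for i
  proof -
    have "a [^] (n * (i div n)) \<otimes> a [^] (i mod n) = a [^] (n * (i div n) + i mod n)"
      using a(1) by (rule nat_pow_mult)
    then show ?thesis using a by (simp add: pow_mult_one)
  qed
  then show ?thesis using ij unfolding cong_def by metis
qed

lemma conj_pow:
  assumes "x \<in> carrier G" "h \<in> carrier G"
  shows "inv x \<otimes> h [^] (k :: nat) \<otimes> x = (inv x \<otimes> h \<otimes> x) [^] k"
proof (induction k)
  case (Suc k)
  have "(inv x \<otimes> h [^] k \<otimes> x) \<otimes> (inv x \<otimes> h \<otimes> x) = inv x \<otimes> h [^] k \<otimes> (x \<otimes> inv x) \<otimes> h \<otimes> x"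
    using assms by (simp only: m_assoc m_closed inv_closed nat_pow_closed)
  then show ?case using Suc assms by (simp add: m_assoc)
qed (use assms in simp)

lemma conj_pow_iterate:
  assumes x: "x \<in> carrier G" and g: "g \<in> carrier G" and k: "inv x \<otimes> g \<otimes> x = g [^] (k :: nat)"
  shows "inv (x [^] (i :: nat)) \<otimes> g \<otimes> x [^] i = g [^] (k ^ i)"
proof (induction i)
  case (Suc i)
  have "inv (x [^] Suc i) \<otimes> g \<otimes> x [^] Suc i = inv x \<otimes> (inv (x [^] i) \<otimes> g \<otimes> x [^] i) \<otimes> x"
    using x g by (simp add: inv_mult_group m_assoc)
  also have "\<dots> = (inv x \<otimes> g \<otimes> x) [^] (k ^ i)" using x g by (simp add: Suc conj_pow)
  also have "\<dots> = g [^] (k ^ Suc i)" using g by (simp add: k nat_pow_pow)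
  finally show ?case .
qed (use g in simp)

end

context fin_group
begin

lemma T_pow: "g \<in> carrier G \<Longrightarrow> T (g [^] (k :: nat)) = T g ^ k"
  by (induction k) (simp_all add: T_one T_mult power_commutes)

definition log1p :: "nat \<Rightarrow> 'a \<Rightarrow> 'a operator" where
  "log1p n b = (\<Sum>k\<in>{1..n}. log1p_coeff n k 1 *\<^sub>R T b ^ k)"

lemma exp_log1p_T:
  assumes "b \<in> carrier G" "b [^] n = \<one>" "odd n"
  shows "exp (log1p n b) = 1 + T b"
  unfolding log1p_def using assms by (intro exp_log1p) (simp_all add: T_one flip: T_pow)

lemma coef_log1p:
  assumes "b \<in> carrier G" "h \<in> carrier G"
  shows "coef h (log1p n b) = (\<Sum>k\<in>{k\<in>{1..n}. b [^] k = h}. log1p_coeff n k 1)"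
proof -
  have "coef h (log1p n b) = (\<Sum>k\<in>{1..n}. if b [^] k = h then log1p_coeff n k 1 else 0)"
    using assms unfolding log1p_def by (auto simp: coef_T simp flip: T_pow intro!: sum.cong)
  then show ?thesis by (simp only: sum.inter_filter finite_atLeastAtMost)
qed

text \<open>
  With \<open>j\<close> odd, \<open>1 + a ^ j\<close> is the product of \<open>1 + a\<close> with the alternating sum of the powers of
  \<open>a\<close> below \<open>j\<close>, and the exponential in question is that alternating sum. An even \<open>j\<close> is
  replaced by the odd number \<open>j + n\<close>.
\<close>

lemma exp_log1p_diff_integral:
  assumes a: "a \<in> carrier G" "a [^] n = \<one>" "odd n" 
  shows "exp (log1p n (a [^] (j :: nat)) - log1p n a) \<in> int_group_alg"
proof -
  define b where "b = a [^] j"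
  have b: "b \<in> carrier G" "b [^] n = \<one>"
    using a by (simp_all add: b_def nat_pow_pow pow_mult_one)
  \<comment> \<open>an odd exponent representing the same power of \<open>a\<close>\<close>
  define j' where "j' = (if odd j then j else j + n)"
  have j': "odd j'" "T a ^ j' = T b"
    using a T_pow[OF a(1), of n] by (auto simp: j'_def b_def T_pow power_add T_one)
  define w where "w = (\<Sum>i<j'. (- T a) ^ i)"
  have w: "w * (1 + T a) = 1 + T b"
    using geometric_sum_mult[of "- T a" j'] j' by (simp add: w_def)
  have comm: "log1p n b * log1p n a = log1p n a * log1p n b"
  proof -
    have "log1p n b = (\<Sum>k\<in>{1..n}. log1p_coeff n k 1 *\<^sub>R T a ^ (j * k))"
      using a by (simp add: log1p_def b_def T_pow power_mult)
    then show ?thesis unfolding log1p_def[of n a]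
      by (simp add: sum_product power_add[symmetric] add.commute) (subst sum.swap, simp add: mult.commute)
  qed
  have "exp (log1p n b - log1p n a) = exp (log1p n b) * exp (- log1p n a)"
    using exp_add_commuting[of "log1p n b" "- log1p n a"] comm by simp
  also have "\<dots> = w * (exp (log1p n a) * exp (- log1p n a))"
    using a b by (simp add: exp_log1p_T flip: w mult.assoc)
  also have "\<dots> = w" by (simp add: exp_minus_inverse)
  finally show ?thesis using a by (simp add: w_def b_def)
qed

text \<open>
  The cut-property, transported to the algebra of operators. Centrality is expressed by invariance under
  conjugation, and that \<open>z\<close> is central then follows from the same property of \<open>u\<close>.
\<close>

definition trivial_central_units :: bool where
  "trivial_central_units \<longleftrightarrow>
     (\<forall>u\<in>int_group_alg. \<forall>v\<in>int_group_alg.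
        u * v = 1 \<and> v * u = 1 \<and> (\<forall>x\<in>carrier G. conj_by x u = u) \<longrightarrow>
        (\<exists>z\<in>carrier G. u = T z \<or> u = - T z))"

text \<open>
  With \<open>t\<close> the sum of all conjugates of \<open>y\<close>, some \<open>exp (k t)\<close> is a central unit \<open>u\<close>. If it is
  trivial, then \<open>u * star u = 1\<close>, that is \<open>exp (k (t + star t)) = 1\<close>, so \<open>t + star t = 0\<close>. The sum in
  the conclusion is the coefficient of \<open>h\<close> in this element.
\<close>

lemma trace_symmetric_zero:
  assumes triv: trivial_central_units and p: "prime (p :: nat)" "order G = p ^ m"
    and C: "subgroup C G" "y \<in> span (T ` C)" "\<And>c. c \<in> C \<Longrightarrow> conj_by c y = y"
    and exp: "exp y \<in> int_group_alg" "exp (- y) \<in> int_group_alg"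
    and h: "h \<in> carrier G"
  shows "(\<Sum>x\<in>carrier G. coef (inv x \<otimes> h \<otimes> x) y + coef (inv x \<otimes> inv h \<otimes> x) y) = 0"
proof -
  interpret C: subgroup C G by fact
  define t where "t = (\<Sum>x\<in>carrier G. conj_by x y)"
  have y: "y \<in> group_alg"
    using C(2) span_mono[of "T ` C" "T ` carrier G"] C.subset by (auto simp: group_alg_def)
  have t: "t \<in> group_alg" using y by (simp add: t_def)
  obtain k :: nat where k: "k > 0" and 
    int: "exp (real k *\<^sub>R t) \<in> int_group_alg" "exp (- (real k *\<^sub>R t)) \<in> int_group_alg"
    unfolding t_def using exp_trace_integral[OF p C exp] by metis
  have conj_t: "conj_by x t = t" if x: "x \<in> carrier G" for x
  proof -
    have "conj_by x t = (\<Sum>z\<in>carrier G. conj_by (x \<otimes> z) y)"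
      using x by (simp add: t_def conj_linear conj_conj)
    also have "\<dots> = t" unfolding t_def
      by (rule sum.reindex_bij_witness[of _ "\<lambda>z. inv x \<otimes> z" "\<lambda>z. x \<otimes> z"])
        (use x in \<open>auto simp flip: m_assoc\<close>)
    finally show ?thesis .
  qed
  let ?u = "exp (real k *\<^sub>R t)"
  have "conj_by x ?u = ?u" if "x \<in> carrier G" for x
    using that conj_t by (simp add: exp_conj conj_linear)
  moreover have "?u * exp (- (real k *\<^sub>R t)) = 1" "exp (- (real k *\<^sub>R t)) * ?u = 1"
    using exp_minus_inverse[of "real k *\<^sub>R t"] exp_minus_inverse[of "- (real k *\<^sub>R t)"] by simp_all
  ultimately obtain z where z: "z \<in> carrier G" "?u = T z \<or> ?u = - T z"
    using triv int unfolding trivial_central_units_def by blast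
  then have "?u * star ?u = 1" by (auto simp: star_T)
  moreover have "t * star t = star t * t"
  proof -
    have "T x * t = t * T x" if "x \<in> carrier G" for x
      using conj_t[OF that] that by (simp add: conj_eq_iff)
    then show ?thesis by (simp add: star_def sum_distrib_left sum_distrib_right)
  qed
  ultimately have "exp (real k *\<^sub>R t + real k *\<^sub>R star t) = 1"
    using t by (simp add: exp_add_commuting exp_star)
  then have "real k *\<^sub>R t + real k *\<^sub>R star t = 0"
    using t by (intro exp_eq_one_self_adjoint) (simp_all add: add.commute)
  then have "real k *\<^sub>R (t + star t) = 0" by (simp add: scaleR_add_right)
  then have "t + star t = 0" using k by simp
  then have "coef h t + coef h (star t) = 0" by (simp flip: coef_simps(1))
  then show ?thesis
    using h y by (simp add: t_def coef_star coef_conj sum.distrib)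
qed

text \<open>
  Apply the previous lemma to the logarithm \<open>y\<close> of \<open>(1 + g ^ j) / (1 + g)\<close>; its exponential and that of
  its negative are integral because \<open>g\<close> is in turn a power of \<open>g ^ j\<close>. Since
  \<open>j\<close>-th powers permute the elements of order dividing \<open>n\<close>, the coefficient of \<open>h ^ j\<close> in the logarithm
  of \<open>1 + g ^ j\<close> equals the coefficient of \<open>h\<close> in the logarithm of \<open>1 + g\<close>.
\<close>

lemma log1p_invariant:
  assumes triv: trivial_central_units and p: "prime (p :: nat)" "order G = p ^ m"
    and g: "g \<in> carrier G" "g [^] n = \<one>" "odd n" and j: "coprime j n"
  defines "s \<equiv> \<lambda>j. \<Sum>x\<in>carrier G. coef ((inv x \<otimes> g \<otimes> x) [^] j) (log1p n g) +
     coef ((inv x \<otimes> inv g \<otimes> x) [^] j) (log1p n g)"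
  shows "s j = s 1"
proof -
  have n: "n > 0" using g(3) by (cases n) auto
  obtain l where "[j * l = 1] (mod n)" using cong_solve_coprime_nat[OF j] by auto
  have jl: "a [^] (j * l) = a" if "a \<in> carrier G" "a [^] n = \<one>" for a
    using pow_cong[OF that \<open>[j * l = 1] (mod n)\<close>] that(1) by simp
  define b where "b = g [^] j"
  have b: "b \<in> carrier G" "b [^] l = g" "b [^] n = \<one>"
    using jl[OF g(1,2)] g(1,2) by (simp_all add: b_def nat_pow_pow pow_mult_one)
  define C where "C = range (\<lambda>k :: nat. g [^] k)"
  have gC: "g [^] k \<in> C" for k :: nat by (auto simp: C_def)
  have C: "subgroup C G"
  proof (rule subgroupI)
    show "C \<subseteq> carrier G" "C \<noteq> {}" using g(1) by (auto simp: C_def)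
  next
    fix a assume "a \<in> C"
    then obtain k :: nat where k: "a = g [^] k" by (auto simp: C_def)
    have "g [^] (k * (n - 1)) \<otimes> g [^] k = g [^] (k * (n - 1) + k)"
      using g(1) by (rule nat_pow_mult)
    also have "k * (n - 1) + k = k * n" using n by (cases n) simp_all
    also have "g [^] (k * n) = \<one>" using g by (simp add: pow_mult_one)
    finally have "inv a = g [^] (k * (n - 1))"
      using g(1) k by (intro inv_equality) simp_all
    then show "inv a \<in> C" using gC by simp
  next
    fix a b assume "a \<in> C" "b \<in> C"
    then show "a \<otimes> b \<in> C" using g(1) by (auto simp: C_def nat_pow_mult)
  qed
  define y where "y = log1p n b - log1p n g"
  have span: "log1p n (g [^] i) \<in> span (T ` C)" for i :: nat
    unfolding log1p_def
  proof (intro span_sum span_scale span_base)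
    fix k
    have "T (g [^] i) ^ k = T (g [^] (i * k))" using g(1) by (simp add: nat_pow_pow flip: T_pow)
    then show "T (g [^] i) ^ k \<in> T ` C" using gC by simp
  qed
  have y_span: "y \<in> span (T ` C)"
    using span[of j] span[of 1] g(1) by (simp add: y_def b_def span_diff del: One_nat_def)
  have y_conj: "conj_by c y = y" if c: "c \<in> C" for c
  proof -
    obtain k :: nat where k: "c = g [^] k" using c by (auto simp: C_def)
    have "T c * T d = T d * T c" if "d \<in> C" for d
      using that g(1) by (auto simp: C_def k T_pow add.commute simp flip: power_add)
    then have "conj_by d (T c) = T c" if "d \<in> C" for d
      using that subgroup.mem_carrier[OF C] by (simp add: conj_eq_iff)
    from span_commutes[OF subgroup.subset[OF C] y_span this]
    show ?thesis using subgroup.mem_carrier[OF C c] by (simp add: conj_eq_iff)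
  qed
  have y_exp: "exp y \<in> int_group_alg" "exp (- y) \<in> int_group_alg"
    using exp_log1p_diff_integral[OF g, of j] exp_log1p_diff_integral[OF b(1,3) g(3), of l] b(2)
    by (simp_all add: y_def b_def)
  have coef_b: "coef (h [^] j) (log1p n b) = coef h (log1p n g)" 
    if h: "h \<in> carrier G" "h [^] n = \<one>" for h
  proof -
    have "b [^] k = h [^] j \<longleftrightarrow> g [^] k = h" for k :: nat
    proof
      assume "b [^] k = h [^] j"
      then have "(b [^] k) [^] l = (h [^] j) [^] l" by simp
      moreover have "(b [^] k) [^] l = (b [^] l) [^] k" using b(1) by (simp add: nat_pow_pow mult.commute)
      then have "(b [^] k) [^] l = g [^] k" using b(2) by simp
      moreover have "(h [^] j) [^] l = h" using jl[OF h] h(1) by (simp add: nat_pow_pow)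
      ultimately show "g [^] k = h" by simp
    next
      assume "g [^] k = h"
      then show "b [^] k = h [^] j" using g(1) by (auto simp: b_def nat_pow_pow mult.commute)
    qed
    then show ?thesis using h(1) g(1) b(1) by (simp add: coef_log1p)
  qed
  have ig: "inv g \<in> carrier G" "inv g [^] n = \<one>" using g by (simp_all add: nat_pow_inv)
  have "0 = (\<Sum>x\<in>carrier G. coef (inv x \<otimes> b \<otimes> x) y + coef (inv x \<otimes> inv b \<otimes> x) y)"
    using trace_symmetric_zero[OF triv p C y_span y_conj y_exp b(1)] by simp
  also have "\<dots> = (\<Sum>x\<in>carrier G. 
    (coef (inv x \<otimes> g \<otimes> x) (log1p n g) + coef (inv x \<otimes> inv g \<otimes> x) (log1p n g)) -
    (coef ((inv x \<otimes> g \<otimes> x) [^] j) (log1p n g) + coef ((inv x \<otimes> inv g \<otimes> x) [^] j) (log1p n g)))"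
  proof (rule sum.cong[OF refl])
    fix x assume x: "x \<in> carrier G"
    have "inv x \<otimes> b \<otimes> x = (inv x \<otimes> g \<otimes> x) [^] j" using x g(1) by (simp add: b_def conj_pow)
    moreover have "inv x \<otimes> inv b \<otimes> x = (inv x \<otimes> inv g \<otimes> x) [^] j"
      using x g(1) by (simp add: b_def conj_pow flip: nat_pow_inv)
    moreover have "(inv x \<otimes> g \<otimes> x) [^] n = \<one>" "(inv x \<otimes> inv g \<otimes> x) [^] n = \<one>"
      using x g ig by (simp_all flip: conj_pow)
    ultimately show "coef (inv x \<otimes> b \<otimes> x) y + coef (inv x \<otimes> inv b \<otimes> x) y = 
      (coef (inv x \<otimes> g \<otimes> x) (log1p n g) + coef (inv x \<otimes> inv g \<otimes> x) (log1p n g)) -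
      (coef ((inv x \<otimes> g \<otimes> x) [^] j) (log1p n g) + coef ((inv x \<otimes> inv g \<otimes> x) [^] j) (log1p n g))"
      using x g(1) ig(1) by (simp add: y_def coef_b)
  qed
  also have "\<dots> = s 1 - s j"
    using g(1) by (simp add: s_def sum_subtractf)
  finally show ?thesis by simp
qed

end

context fin_group
begin

text \<open>
  The invariance is summed over all \<open>j\<close> in the classes of \<open>a\<close> and \<open>- a\<close> modulo 9. Only conjugates of \<open>g\<close>
  inside \<open>\<langle>g\<rangle>\<close> contribute, and if these are all of the form \<open>g ^ k\<close> with \<open>k\<close> congruent to 1 or -1 modulo 9, then
  multiplication by \<open>k\<close> permutes the chosen \<open>j\<close>. So up to a factor that does not depend on \<open>a\<close>, the
  sum is the one of the coefficients \<open>log1p_coeff n j 1\<close>.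
\<close>

lemma sum_log1p_over_classes:
  assumes triv: trivial_central_units and p: "prime (p :: nat)" "order G = p ^ m"
    and g: "g \<in> carrier G" and n: "n = ord g" "n = 9 * q" "n = 3 ^ e"
    and contra: "\<And>x k. x \<in> carrier G \<Longrightarrow> inv x \<otimes> g \<otimes> x = g [^] (k :: nat) \<Longrightarrow> k mod 9 \<in> {1, 8}"
  obtains r :: real where "\<And>a :: nat. a \<in> {1, 2} \<Longrightarrow> 
    (\<Sum>j\<in>{j. j < n \<and> j mod 9 \<in> {a, 9 - a}}. log1p_coeff n j 1) = r"
proof -
  have gn: "g [^] n = \<one>" using g by (simp add: n(1))
  have n0: "n > 0" using n(3) by simp
  have odd: "odd n" by (simp add: n(3))
  have q: "q > 0" using n0 n(2) by simp
  let ?l = "log1p n g"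
  define c where "c x = inv x \<otimes> g \<otimes> x" for x
  have c: "c x \<in> carrier G" "c x [^] n = \<one>" if "x \<in> carrier G" for x
    using that g gn conj_pow[of x g n] by (simp_all add: c_def)
  define F where "F j = (\<Sum>x\<in>carrier G. coef (c x [^] j) ?l)" for j :: nat
  define N where "N = {x \<in> carrier G. \<exists>k :: nat. c x = g [^] k}"
  have coprime: "coprime j n" if "\<not> 3 dvd j" for j :: nat
  proof -
    have "prime (3 :: nat)" by simp
    then have "coprime 3 j" using that by (rule prime_imp_coprime)
    then show ?thesis by (simp add: n(3) coprime_commute)
  qed
  have inv_pow: "inv (c x) [^] j = c x [^] (n - j)" if "x \<in> carrier G" "j \<le> n" for x j
  proof -
    have "c x [^] (n - j) \<otimes> c x [^] j = c x [^] (n - j + j)"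
      using c(1)[OF that(1)] by (rule nat_pow_mult)
    then have "c x [^] (n - j) \<otimes> c x [^] j = \<one>" using that c by simp
    then show ?thesis using that c by (simp add: nat_pow_inv inv_equality)
  qed
  \<comment> \<open>the invariance under \<open>j\<close>, with inverses written as powers \<open>n - j\<close>\<close>
  have sym: "F j + F (n - j) = F 1 + F (n - 1)" if j: "\<not> 3 dvd j" "j \<le> n" for j
  proof -
    have inv_c: "inv x \<otimes> inv g \<otimes> x = inv (c x)" if "x \<in> carrier G" for x
      using that g by (simp add: c_def inv_mult_group m_assoc)
    have "F i + F (n - i) = (\<Sum>x\<in>carrier G. coef ((inv x \<otimes> g \<otimes> x) [^] i) ?l +
      coef ((inv x \<otimes> inv g \<otimes> x) [^] i) ?l)" if "i \<le> n" for i
      unfolding F_def sum.distrib[symmetric] 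
      by (rule sum.cong[OF refl]) (simp add: inv_c inv_pow that flip: c_def)
    from this[of j] this[of 1] show ?thesis
      using log1p_invariant[OF triv p g gn odd coprime[OF j(1)]] j(2) n0 by simp
  qed
  have val: "(\<Sum>j\<in>{j. j < n \<and> j mod 9 \<in> {a, 9 - a}}. log1p_coeff n j 1) = 
     real q * (F 1 + F (n - 1)) / real (card N)" if a: "a \<in> {1, 2}" for a :: nat
  proof -
    define J where "J = {j. j < n \<and> j mod 9 \<in> {a, 9 - a}}"
    have finJ: "finite J" by (simp add: J_def)
    have J3: "\<not> 3 dvd j" if "j \<in> J" for j
    proof -
      have "j mod 9 = 1 \<or> j mod 9 = 2 \<or> j mod 9 = 7 \<or> j mod 9 = 8" using that a by (auto simp: J_def)
      then show ?thesis by presburger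
    qed
    have "real (card J) = (\<Sum>j\<in>J. 1)" by simp
    also have "\<dots> = 2 * real q"
      unfolding J_def using a by (subst sum_two_classes_mod_9[OF n(2)]) auto
    finally have cardJ: "real (card J) = 2 * real q" .
    have flip: "n - j \<in> J" "n - (n - j) = j" if j: "j \<in> J" for j
    proof -
      have j0: "0 < j" "j < n" using j J3[of j] by (auto simp: J_def intro: gr0I)
      then show "n - (n - j) = j" by simp
      have "n = 9 * (j div 9) + j mod 9 + (n - j)" using j0 by simp
      then have nj: "(j mod 9 + (n - j)) mod 9 = 0" 
        using n(2) by (metis add.assoc mod_mult_self2 mod_mult_self1_is_0 add.commute)
      define i where "i = n - j"
      have "j mod 9 \<in> {a, 9 - a}" using j by (simp add: J_def)
      then have "(a, j mod 9) \<in> {(1, 1), (1, 8), (2, 2), (2, 7)}" using a by auto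
      moreover have "(1 + i) mod 9 = 0 \<Longrightarrow> i mod 9 = 8" "(8 + i) mod 9 = 0 \<Longrightarrow> i mod 9 = 1"
        "(2 + i) mod 9 = 0 \<Longrightarrow> i mod 9 = 7" "(7 + i) mod 9 = 0 \<Longrightarrow> i mod 9 = 2"
        by presburger+
      moreover have "(j mod 9 + i) mod 9 = 0" using nj by (simp only: i_def)
      ultimately have "i mod 9 \<in> {a, 9 - a}" by (elim insertE emptyE Pair_inject) simp_all
      then have "(n - j) mod 9 \<in> {a, 9 - a}" by (simp only: i_def)
      then show "n - j \<in> J" using j0 by (simp add: J_def)
    qed
    have "(\<Sum>j\<in>J. F j) = (\<Sum>j\<in>J. F (n - j))"
      by (rule sum.reindex_bij_witness[of _ "\<lambda>j. n - j" "\<lambda>j. n - j"]) (simp_all add: flip)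
    then have "2 * (\<Sum>j\<in>J. F j) = (\<Sum>j\<in>J. F j + F (n - j))" by (simp add: sum.distrib)
    also have "\<dots> = (\<Sum>j\<in>J. F 1 + F (n - 1))"
      by (rule sum.cong[OF refl]) (rule sym, auto simp: J3, auto simp: J_def)
    also have "\<dots> = 2 * real q * (F 1 + F (n - 1))" by (simp add: cardJ)
    finally have FJ: "(\<Sum>j\<in>J. F j) = real q * (F 1 + F (n - 1))" by simp
    have coefJ: "coef (g [^] j) ?l = log1p_coeff n j 1" if "j \<in> J" for j
    proof -
      have j: "0 < j" "j < n" using that J3[of j] by (auto simp: J_def intro: gr0I)
      have "inj_on (\<lambda>i :: nat. g [^] i) {1..n}" using ord_inj'[OF g] by (simp add: n(1))
      then have "{k \<in> {1..n}. g [^] k = g [^] j} = {j}"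
        using j by (auto dest: inj_onD)
      then show ?thesis using g by (simp add: coef_log1p)
    qed
    have "(\<Sum>j\<in>J. coef (c x [^] j) ?l) = (if x \<in> N then \<Sum>j\<in>J. log1p_coeff n j 1 else 0)"
      if x: "x \<in> carrier G" for x
    proof (cases "x \<in> N")
      case True
      then obtain k :: nat where k: "c x = g [^] k" by (auto simp: N_def)
      then have k9: "k mod 9 \<in> {1, 8}" using contra x by (simp add: c_def)
      then have "k mod 9 = 1 \<or> k mod 9 = 8" by simp
      then have "\<not> 3 dvd k" by presburger
      then have cop: "coprime k n" by (rule coprime)
      let ?f = "\<lambda>j. k * j mod n"
      have "?f ` J \<subseteq> J"
      proof
        fix i assume "i \<in> ?f ` J"
        then obtain j where j: "j \<in> J" "i = k * j mod n" by auto
        have "i mod 9 = (k * j) mod 9" by (simp add: j n(2) mod_mod_cancel)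
        also have "\<dots> = ((k mod 9) * (j mod 9)) mod 9" by (simp add: mod_mult_eq)
        also have "\<dots> \<in> {a, 9 - a}" using k9 a j(1) by (auto simp: J_def)
        finally show "i \<in> J" using n0 j by (simp add: J_def)
      qed
      moreover have inj: "inj_on ?f J"
      proof (rule inj_onI)
        fix i j assume ij: "i \<in> J" "j \<in> J" "k * i mod n = k * j mod n"
        then have "[k * i = k * j] (mod n)" by (simp add: cong_def)
        then have "[i = j] (mod n)" using cop by (simp add: cong_mult_lcancel_nat)
        then show "i = j" using ij by (simp add: J_def cong_def)
      qed
      ultimately have img: "?f ` J = J" using finJ by (simp add: endo_inj_surj)
      have "(\<Sum>j\<in>J. coef (c x [^] j) ?l) = (\<Sum>j\<in>J. coef (g [^] (?f j)) ?l)"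
      proof (rule sum.cong[OF refl])
        fix j
        have "c x [^] j = g [^] (k * j)" using g by (simp add: k nat_pow_pow)
        also have "\<dots> = g [^] (k * j mod n)" by (rule pow_cong[OF g gn]) (simp add: cong_def)
        finally show "coef (c x [^] j) ?l = coef (g [^] (?f j)) ?l" by simp
      qed
      also have "\<dots> = (\<Sum>j\<in>J. coef (g [^] j) ?l)"
        using sum.reindex[OF inj, of "\<lambda>j. coef (g [^] j) ?l"] img by simp
      finally show ?thesis using True coefJ by simp
    next
      case False
      have "coef (c x [^] j) ?l = 0" if j: "j \<in> J" for j
      proof -
        obtain l where l: "[j * l = 1] (mod n)" using cong_solve_coprime_nat[OF coprime[OF J3[OF j]]] by auto
        have "g [^] k \<noteq> c x [^] j" for k :: nat
        proof
          assume "g [^] k = c x [^] j"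
          then have "(g [^] k) [^] l = (c x [^] j) [^] l" by simp
          then have "g [^] (k * l) = c x [^] (j * l)" using g c[OF x] by (simp add: nat_pow_pow)
          also have "\<dots> = c x [^] (1 :: nat)" by (rule pow_cong[OF c[OF x] l])
          finally have "c x = g [^] (k * l)" using c[OF x] by simp
          then show False using False x unfolding N_def by blast
        qed
        then show ?thesis using g c[OF x] by (simp add: coef_log1p)
      qed
      then show ?thesis using False by simp
    qed
    then have "(\<Sum>x\<in>carrier G. \<Sum>j\<in>J. coef (c x [^] j) ?l) = 
      (\<Sum>x\<in>carrier G. if x \<in> N then \<Sum>j\<in>J. log1p_coeff n j 1 else 0)" by simp
    also have "\<dots> = (\<Sum>x\<in>N. \<Sum>j\<in>J. log1p_coeff n j 1)"
      using fin by (simp add: sum.If_cases N_def Int_def conj_ac cong: conj_cong)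
    also have "\<dots> = real (card N) * (\<Sum>j\<in>J. log1p_coeff n j 1)" by simp
    finally have "(\<Sum>j\<in>J. F j) = real (card N) * (\<Sum>j\<in>J. log1p_coeff n j 1)"
      unfolding F_def by (subst sum.swap)
    moreover have "card N > 0"
    proof -
      have "c \<one> = g [^] (1 :: nat)" using g by (simp add: c_def)
      then have "\<one> \<in> N" unfolding N_def by blast
      moreover have "finite N" using fin by (simp add: N_def)
      ultimately show ?thesis by (auto simp: card_gt_0_iff)
    qed
    ultimately show ?thesis using FJ by (simp add: J_def field_simps)
  qed
  show ?thesis by (rule that[OF val])
qed

text \<open>
  The two integrals differ, so some conjugate \<open>g ^ k\<close> of \<open>g\<close> has \<open>k\<close> not congruent to 1 or -1
  modulo 9. Conjugation by \<open>x\<close> has 3-power order, which forces \<open>k\<close> to be 1 modulo 3. Hence \<open>k\<close> is 4 or 7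
  modulo 9 and some power of it is -2 modulo the order of \<open>g\<close>.
\<close>

lemma square_conj_inverse_if_trivial_central_units:
  assumes triv: trivial_central_units and order: "order G = 3 ^ m" and g: "g \<in> carrier G"
  shows "\<exists>x\<in>carrier G. inv x \<otimes> g [^] (2 :: nat) \<otimes> x = inv g"
proof -
  have p3: "prime (3 :: nat)" by simp
  have "ord g dvd 3 ^ m" using ord_dvd_group_order[OF g] order by simp
  then obtain e where e: "ord g = 3 ^ e" using p3 by (auto simp: divides_primepow_nat)
  have gn: "g [^] ord g = \<one>" using g by simp
  show ?thesis
  proof (cases "e \<le> 1")
    case True
    then have "ord g dvd 3" using e le_imp_power_dvd[of e 1 3] by simp
    then have "g [^] (3 :: nat) = \<one>" using g pow_eq_id by simp
    then have "g [^] (2 :: nat) \<otimes> g = \<one>" using g by (simp add: numeral_eq_Suc)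
    then show ?thesis using g by (intro bexI[of _ \<one>]) (simp_all add: inv_equality)
  next
    case False
    define q where "q = (3 :: nat) ^ (e - 2)"
    have q: "ord g = 9 * q" "odd q"
    proof -
      have "e = 2 + (e - 2)" using False by simp
      then have "(3 :: nat) ^ e = 3 ^ 2 * 3 ^ (e - 2)" by (metis power_add)
      then show "ord g = 9 * q" by (simp add: e q_def)
    qed (simp add: q_def)
    have "\<exists>x k. x \<in> carrier G \<and> inv x \<otimes> g \<otimes> x = g [^] (k :: nat) \<and> k mod 9 \<notin> {1, 8}"
    proof (rule ccontr)
      assume "\<not> ?thesis"
      then obtain r :: real where r: "\<And>a :: nat. a \<in> {1, 2} \<Longrightarrow> 
        (\<Sum>j\<in>{j. j < ord g \<and> j mod 9 \<in> {a, 9 - a}}. log1p_coeff (ord g) j 1) = r"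
        using sum_log1p_over_classes[OF triv p3 order g refl q(1) e] by blast
      show False using r[of 1] r[of 2] integral_log1p_difference[OF q(2,1)] by (simp del: One_nat_def)
    qed
    then obtain x k where x: "x \<in> carrier G" and k: "inv x \<otimes> g \<otimes> x = g [^] (k :: nat)" "k mod 9 \<notin> {1, 8}"
      by blast
    note pow = conj_pow_iterate[OF x g k(1)]
    have "x [^] (3 ^ m :: nat) = \<one>" using pow_order_eq_1[OF x] order by simp
    then have "g = g [^] (k ^ 3 ^ m)" using pow[of "3 ^ m"] g by simp
    then have "g [^] int (k ^ 3 ^ m) = g [^] int 1" using g unfolding int_pow_int by simp
    then have "[k ^ 3 ^ m = 1] (mod ord g)"
      using int_pow_eq[OF g] by (simp add: cong_iff_dvd_diff dvd_diff_commute del: of_nat_power flip: cong_int_iff)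
    moreover have "3 dvd ord g" using q by simp
    ultimately have cong: "[k ^ 3 ^ m = 1] (mod 3)" using cong_dvd_modulus_nat by blast
    have "k mod 3 = 1"
    proof -
      consider "k mod 3 = 0" | "k mod 3 = 1" | "k mod 3 = 2" by linarith
      then show ?thesis
      proof cases
        case 1
        then have "3 dvd k ^ 3 ^ m" by (simp add: dvd_power_iff mod_eq_0_iff_dvd dvd_power_same prime_dvd_power_iff)
        then show ?thesis using cong by (simp add: cong_def mod_eq_0_iff_dvd)
      next
        case 3
        then have "int k mod 3 = 2" using zmod_int[of k 3] by simp
        then have "[int k = - 1] (mod 3)" by (simp add: cong_def)
        then have "[int k ^ 3 ^ m = (- 1) ^ 3 ^ m] (mod 3)" by (rule cong_pow)
        moreover have "[int k ^ 3 ^ m = 1] (mod 3)" using cong by (metis cong_int_iff of_nat_1 of_nat_numeral of_nat_power)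
        ultimately have "[(1 :: int) = - 1] (mod 3)" by (simp add: cong_def)
        then show ?thesis by (simp add: cong_def)
      qed
    qed
    then have "k mod 9 = 1 \<or> k mod 9 = 4 \<or> k mod 9 = 7" by presburger
    then have "k mod 9 \<in> {4, 7}" using k(2) by auto
    then have "k mod 9 = 4 \<or> k mod 9 = 7" by simp
    moreover have "int k mod 9 = int (k mod 9)" by (simp add: zmod_int)
    ultimately have "int k mod 9 \<in> {4, 7}" by auto
    then obtain i where "[int k ^ i = - 2] (mod 3 ^ e)" 
      using pow_surj_mod_three_power[of "int k" "- 2" e] by auto
    then have "int (3 ^ e) dvd int (k ^ i + 2)" by (simp add: cong_iff_dvd_diff add.commute)
    then have "ord g dvd k ^ i + 2" by (simp only: e int_dvd_int_iff)
    then have "g [^] (k ^ i + 2) = \<one>" using g pow_eq_id by blast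
    moreover have "g [^] (2 :: nat) \<otimes> g [^] (k ^ i) = g [^] (2 + k ^ i)" using g by (rule nat_pow_mult)
    ultimately have "g [^] (2 :: nat) \<otimes> g [^] (k ^ i) = \<one>" by (simp add: add.commute)
    then have "inv (g [^] (k ^ i)) = g [^] (2 :: nat)" using g by (intro inv_equality) simp_all
    moreover have "inv (g [^] (k ^ i)) = inv (x [^] i) \<otimes> inv g \<otimes> x [^] i"
      unfolding pow[symmetric] using x g by (simp add: inv_mult_group m_assoc)
    ultimately have "x [^] i \<otimes> g [^] (2 :: nat) \<otimes> inv (x [^] i) = 
      x [^] i \<otimes> (inv (x [^] i) \<otimes> inv g \<otimes> x [^] i) \<otimes> inv (x [^] i)" by simp
    also have "\<dots> = inv g" using x g by (simp add: conj_inverse_cancel)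
    finally show ?thesis using x by (intro bexI[of _ "inv (x [^] i)"]) simp_all
  qed
qed

end

section \<open>Traces of idempotents\<close>

text \<open>
  A triangular form of an idempotent matrix is again idempotent, so its diagonal entries are 0 or 1.
\<close>

lemma idempotent_trace_Ints:
  fixes A :: "complex mat"
  assumes A: "A \<in> carrier_mat n n" and idem: "A * A = A"
  shows "(\<Sum>i<n. A $$ (i, i)) \<in> \<int>"
proof -
  obtain es where "char_poly A = (\<Prod>a\<leftarrow>es. [:- a, 1:])"
    using char_poly_factorized[OF A] by auto
  from schur_decomposition_exists[OF A this] obtain B
    where B: "B \<in> carrier_mat n n" "upper_triangular B" "similar_mat A B" by auto
  obtain P Q where "similar_mat_wit A B P Q" using B(3) by (auto simp: similar_mat_def)
  from similar_mat_witD2[OF A this] have PQ: "P * Q = 1\<^sub>m n" "Q * P = 1\<^sub>m n" "A = P * B * Q"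
    "P \<in> carrier_mat n n" "Q \<in> carrier_mat n n" by auto
  have B_eq: "B = Q * A * P"
  proof -
    have "Q * A * P = (Q * P) * B * (Q * P)"
      unfolding PQ(3) using B(1) PQ(4,5) by (simp add: assoc_mult_mat[of _ n n _ n _ n])
    then show ?thesis using B(1) by (simp add: PQ(2))
  qed
  have "B * B = Q * (A * (P * Q) * A) * P"
    unfolding B_eq using A PQ(4,5) by (simp add: assoc_mult_mat[of _ n n _ n _ n])
  also have "\<dots> = B" using A by (simp add: PQ(1) idem B_eq)
  finally have idemB: "B * B = B" .
  have entry: "(M * N) $$ (i, j) = (\<Sum>k<n. M $$ (i, k) * N $$ (k, j))"
    if "M \<in> carrier_mat n n" "N \<in> carrier_mat n n" "i < n" "j < n" for M N :: "complex mat" and i j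
    using that by (auto simp: scalar_prod_def lessThan_atLeast0 intro!: sum.cong)
  have "B $$ (i, i) \<in> \<int>" if i: "i < n" for i
  proof -
    have "B $$ (i, i) = (\<Sum>k<n. B $$ (i, k) * B $$ (k, i))"
      using entry[OF B(1) B(1) i i] by (simp add: idemB)
    also have "\<dots> = (\<Sum>k<n. if k = i then B $$ (i, i) * B $$ (i, i) else 0)"
    proof (rule sum.cong[OF refl])
      fix k assume "k \<in> {..<n}"
      then show "B $$ (i, k) * B $$ (k, i) = (if k = i then B $$ (i, i) * B $$ (i, i) else 0)"
        using B(1) i upper_triangularD[OF B(2), of k i] upper_triangularD[OF B(2), of i k]
        by (cases k i rule: linorder_cases) auto
    qed
    also have "\<dots> = B $$ (i, i) * B $$ (i, i)" using i by simp
    finally have "B $$ (i, i) = 0 \<or> B $$ (i, i) = 1" by auto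
    then show ?thesis by auto
  qed
  then have "(\<Sum>i<n. B $$ (i, i)) \<in> \<int>" by (intro Ints_sum) auto
  moreover have "(\<Sum>i<n. A $$ (i, i)) = (\<Sum>i<n. B $$ (i, i))"
  proof -
    have BQ: "B * Q \<in> carrier_mat n n" using B(1) PQ(5) by simp
    have A_eq: "A = P * (B * Q)" and B_eq': "B = (B * Q) * P"
      using B(1) PQ by (simp_all add: assoc_mult_mat[of _ n n _ n _ n])
    have "(\<Sum>i<n. A $$ (i, i)) = (\<Sum>i<n. \<Sum>k<n. P $$ (i, k) * (B * Q) $$ (k, i))"
      using entry[OF PQ(4) BQ] by (subst A_eq) simp
    also have "\<dots> = (\<Sum>k<n. \<Sum>i<n. (B * Q) $$ (k, i) * P $$ (i, k))"
      by (subst sum.swap) (simp add: mult.commute)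
    also have "\<dots> = (\<Sum>i<n. B $$ (i, i))"
      using entry[OF BQ PQ(4)] by (subst (2) B_eq') simp
    finally show ?thesis .
  qed
  ultimately show ?thesis by simp
qed

context fin_group
begin

text \<open>
  In the basis of group elements, multiplication by \<open>f\<close> has all diagonal entries equal to the
  coefficient of \<open>f\<close> at the identity.
\<close>

lemma idempotent_coef_one:
  assumes f: "f \<in> group_alg" "f * f = f"
  shows "real (order G) * coef \<one> f \<in> \<int>"
proof -
  define n where "n = order G"
  obtain b where b: "bij_betw b {..<n} (carrier G)"
    using ex_bij_betw_nat_finite[OF fin] by (auto simp: n_def Coset.order_def lessThan_atLeast0)
  have bG: "b i \<in> carrier G" if "i < n" for i using b that by (auto simp: bij_betw_def)
  define A where "A = mat n n (\<lambda>(i, j). complex_of_real (coef (b i \<otimes> inv (b j)) f))"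
  have A: "A \<in> carrier_mat n n" by (simp add: A_def)
  have "A * A = A"
  proof (rule eq_matI)
    fix i j assume "i < dim_row A" "j < dim_col A"
    then have ij: "i < n" "j < n" by (auto simp: A_def)
    have cancel: "c \<otimes> (inv c \<otimes> z) = z" "inv c \<otimes> (c \<otimes> z) = z" 
      if "c \<in> carrier G" "z \<in> carrier G" for c z
      using that by (simp_all flip: m_assoc)
    have "(A * A) $$ (i, j) = complex_of_real (\<Sum>k<n. coef (b i \<otimes> inv (b k)) f * coef (b k \<otimes> inv (b j)) f)"
      using ij by (simp add: A_def scalar_prod_def lessThan_atLeast0)
    also have "(\<Sum>k<n. coef (b i \<otimes> inv (b k)) f * coef (b k \<otimes> inv (b j)) f) =
      (\<Sum>z\<in>carrier G. coef (b i \<otimes> inv z) f * coef (z \<otimes> inv (b j)) f)"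
      by (rule sum.reindex_bij_betw[OF b])
    also have "\<dots> = (\<Sum>y\<in>carrier G. coef y f * coef (inv y \<otimes> (b i \<otimes> inv (b j))) f)"
      by (rule sum.reindex_bij_witness[of _ "\<lambda>y. inv y \<otimes> b i" "\<lambda>z. b i \<otimes> inv z"])
        (use bG[OF ij(1)] bG[OF ij(2)] in \<open>auto simp: inv_mult_group m_assoc cancel\<close>)
    also have "\<dots> = coef (b i \<otimes> inv (b j)) (f * f)"
      using bG[OF ij(1)] bG[OF ij(2)] f(1) by (simp add: coef_mult)
    finally show "(A * A) $$ (i, j) = A $$ (i, j)" using ij by (simp add: f(2) A_def)
  qed (auto simp: A_def)
  from idempotent_trace_Ints[OF A this]
  have "complex_of_real (real n * coef \<one> f) \<in> \<int>"
    using bG by (simp add: A_def)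
  then show ?thesis unfolding n_def[symmetric] 
    by (metis Ints_cases of_real_eq_iff of_real_of_int_eq Ints_of_int)
qed

end

section \<open>Spectral idempotents of self-adjoint elements\<close>

text \<open>
  Evaluation of real polynomials in an algebra that need not be commutative; the function \<open>poly\<close> evaluates
  only within the coefficient ring.
\<close>

definition peval :: "real poly \<Rightarrow> 'b :: real_algebra_1 \<Rightarrow> 'b" where
  "peval p v = fold_coeffs (\<lambda>c b. c *\<^sub>R 1 + v * b) p 0"

lemma peval_0 [simp]: "peval 0 v = 0"
  by (simp add: peval_def)

lemma peval_pCons [simp]: "peval (pCons c p) v = c *\<^sub>R 1 + v * peval p v"
  by (cases "p = 0 \<and> c = 0") (auto simp: peval_def)

lemma peval_add: "peval (p + q) v = peval p v + peval q v"
  by (induction p q rule: poly_induct2) (simp_all add: algebra_simps)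

lemma peval_smult: "peval (smult c p) v = c *\<^sub>R peval p v"
  by (induction p) (simp_all add: algebra_simps)

lemma peval_mult: "peval (p * q) v = peval p v * peval q v"
  by (induction p) (simp_all add: peval_add peval_smult algebra_simps)

lemma peval_commute: "peval p v * peval q v = peval q v * peval p v"
  by (metis peval_mult mult.commute)

lemma peval_monom: "peval (monom c i) v = c *\<^sub>R v ^ i"
  by (induction i) (simp_all add: monom_0 monom_Suc)

lemma peval_sum: "peval (sum f I) v = (\<Sum>i\<in>I. peval (f i) v)"
  by (induction I rule: infinite_finite_induct) (simp_all add: peval_add)

lemma peval_eigenvector:
  assumes "v * x = r *\<^sub>R x"
  shows "peval p v * x = poly p r *\<^sub>R x"
proof (induction p)
  case (pCons c p)
  have "peval (pCons c p) v * x = c *\<^sub>R x + v * (peval p v * x)" by (simp add: algebra_simps)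
  also have "\<dots> = poly (pCons c p) r *\<^sub>R x"
    by (simp add: pCons assms algebra_simps)
  finally show ?case .
qed simp

lemma linear_relation_in_finite_span:
  fixes f :: "nat \<Rightarrow> 'b :: real_vector"
  assumes S: "finite S" "card S \<le> n" and f: "\<And>i. f i \<in> span S"
  obtains u where "(\<Sum>i\<le>n. u i *\<^sub>R f i) = 0" "\<exists>i\<le>n. u i \<noteq> 0"
proof (cases "inj_on f {..n}")
  case True
  have "card (f ` {..n}) = Suc n" using True by (simp add: card_image)
  then have "\<not> card (f ` {..n}) \<le> card S" using S by simp
  then have "dependent (f ` {..n})"
    using independent_span_bound[OF S(1), of "f ` {..n}"] f by blast
  then obtain w x where w: "x \<in> f ` {..n}" "w x \<noteq> 0" "(\<Sum>y\<in>f ` {..n}. w y *\<^sub>R y) = 0"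
    by (auto simp: dependent_finite)
  show ?thesis
  proof (rule that[of "\<lambda>i. w (f i)"])
    show "(\<Sum>i\<le>n. w (f i) *\<^sub>R f i) = 0" using w(3) True by (simp add: sum.reindex)
    show "\<exists>i\<le>n. w (f i) \<noteq> 0" using w by auto
  qed
next
  case False
  then obtain i j where ij: "i \<le> n" "j \<le> n" "i \<noteq> j" "f i = f j" by (auto simp: inj_on_def)
  let ?u = "\<lambda>k. if k = i then 1 else if k = j then - 1 else (0 :: real)"
  have "(\<Sum>k\<le>n. ?u k *\<^sub>R f k) = (\<Sum>k\<in>{i, j}. ?u k *\<^sub>R f k)"
    using ij by (intro sum.mono_neutral_right) auto
  then have "(\<Sum>k\<le>n. ?u k *\<^sub>R f k) = 0" using ij by simp
  moreover have "\<exists>k\<le>n. ?u k \<noteq> 0" using ij(1) by (intro exI[of _ i]) simp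
  ultimately show ?thesis by (rule that)
qed

lemma poly_map_complex: "poly (map_poly complex_of_real p) z = peval p z"
  by (induction p) (simp_all add: map_poly_pCons scaleR_conv_of_real)

text \<open>
  The remainder modulo the quadratic is a real linear polynomial with a nonreal root, hence 0.
\<close>

lemma nonreal_root_quadratic_dvd:
  fixes p :: "real poly"
  assumes "peval p z = 0" "Im z \<noteq> 0"
  shows "[:(Re z)\<^sup>2 + (Im z)\<^sup>2, - 2 * Re z, 1:] dvd p"
proof -
  define q where "q = [:(Re z)\<^sup>2 + (Im z)\<^sup>2, - 2 * Re z, 1:]"
  have "degree q = 2" "q \<noteq> 0" by (simp_all add: q_def)
  then have "p mod q = 0 \<or> degree (p mod q) < 2" using degree_mod_less[of q p] by simp
  then have "degree (p mod q) \<le> 1" by auto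
  have "\<exists>c d. p mod q = [:c, d:]"
  proof (cases "p mod q")
    case (pCons c r)
    then have "degree r = 0" using \<open>degree (p mod q) \<le> 1\<close> by (auto split: if_splits)
    then show ?thesis using pCons by (auto elim: degree_eq_zeroE)
  qed
  then obtain c d where cd: "p mod q = [:c, d:]" by blast
  have "peval q z = 0"
    by (simp add: q_def complex_eq_iff power2_eq_square algebra_simps)
  then have "peval (p div q * q + p mod q) z = peval (p mod q) z"
    unfolding peval_add peval_mult by simp
  then have "peval p z = peval (p mod q) z" by simp
  then have "c *\<^sub>R 1 + z * (d *\<^sub>R 1) = 0"
    using assms(1) by (simp add: cd)
  then have "d = 0" "c = 0" using assms(2) by (auto simp: complex_eq_iff)
  then show ?thesis unfolding q_def[symmetric] by (simp add: cd dvd_eq_mod_eq_0)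
qed

lemma common_denominator:
  assumes "finite A" "\<And>x. x \<in> A \<Longrightarrow> f x \<in> \<rat>"
  obtains D :: nat where "D > 0" "\<And>x. x \<in> A \<Longrightarrow> real D * f x \<in> \<int>"
proof -
  have "\<exists>D::nat. D > 0 \<and> (\<forall>x\<in>A. real D * f x \<in> \<int>)"
    using assms
  proof (induction A rule: finite_induct)
    case (insert a A)
    then obtain D :: nat where D: "D > 0" "\<And>x. x \<in> A \<Longrightarrow> real D * f x \<in> \<int>" by auto
    obtain i :: int and n :: nat where n: "n > 0" "f a = of_int i / of_nat n"
      using insert.prems[of a] by (auto simp: Rats_eq_int_div_nat)
    have "real (D * n) * f x \<in> \<int>" if "x \<in> insert a A" for x
    proof (cases "x = a")
      case True
      then have "real (D * n) * f x = of_int (int D * i)" using n by simp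
      then show ?thesis by (metis Ints_of_int)
    next
      case False
      then have "real D * f x \<in> \<int>" using that D(2)[of x] by simp
      then have "real n * (real D * f x) \<in> \<int>" by (rule Ints_mult[OF Ints_of_nat])
      moreover have "real n * (real D * f x) = real (D * n) * f x" by simp
      ultimately show ?thesis by (rule back_subst)
    qed
    then show ?case using D(1) n(1) by (intro exI[of _ "D * n"]) simp
  qed (auto intro: exI[of _ 1])
  then show ?thesis using that by blast
qed

context fin_group
begin

lemma star_peval: "v \<in> group_alg \<Longrightarrow> star v = v \<Longrightarrow> star (peval p v) = peval p v"
  and peval_in_group_alg: "v \<in> group_alg \<Longrightarrow> peval p v \<in> group_alg"
proof -
  show in_alg: "peval p v \<in> group_alg" if "v \<in> group_alg" for p
    using that by (induction p) simp_all
  show "star (peval p v) = peval p v" if v: "v \<in> group_alg" "star v = v"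
  proof (induction p)
    case (pCons c p)
    have "v * peval p v = peval p v * v" using peval_commute[of "[:0, 1:]" v p] by simp
    then show ?case using pCons v in_alg[OF v(1)] by (simp add: star_mult)
  qed simp
qed

text \<open>
  Let \<open>p\<close> be a polynomial of least degree with \<open>p(v) h = 0\<close>, where \<open>h = v\<^sup>2 - 1\<close>, and let \<open>z\<close> be a complex
  root of \<open>p\<close>. If \<open>z\<close> were not real, a factor \<open>(X - Re z)\<^sup>2 + (Im z)\<^sup>2\<close> could be removed from \<open>p\<close>, since
  a sum of squares of self-adjoint elements vanishes only if each does. So \<open>p = (X - r) q\<close> with \<open>r\<close>
  real, and \<open>x = q(v) h\<close> is a nonzero eigenvector for \<open>r\<close>. It is a polynomial in \<open>v\<close>, so \<open>x * x\<close> is the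
  multiple of \<open>x\<close> by \<open>q(r) (r\<^sup>2 - 1)\<close>. As \<open>x * x \<noteq> 0\<close>, this factor is nonzero; dividing by it gives the idempotent,
  and \<open>r\<^sup>2 \<noteq> 1\<close>.
\<close>

lemma self_adjoint_eigen_idempotent:
  assumes v: "v \<in> group_alg" "star v = v" and ne: "v * v \<noteq> 1"
  obtains q r where "peval q v \<noteq> 0" "peval q v * peval q v = peval q v"
    "v * peval q v = r *\<^sub>R peval q v" "r\<^sup>2 \<noteq> (1 :: real)"
proof -
  define d where "d = [:- 1, 0, 1 :: real:]"
  define h where "h = peval d v"
  have h: "h \<noteq> 0" using ne by (simp add: h_def d_def)
  define P where "P p \<longleftrightarrow> p \<noteq> 0 \<and> peval p v * h = 0" for p
  have "\<exists>p. P p"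
  proof -
    let ?n = "card (T ` carrier G)"
    have "v ^ i * h \<in> span (T ` carrier G)" for i
      using v peval_in_group_alg[OF v(1)] by (simp add: h_def flip: group_alg_def)
    then obtain u where u: "(\<Sum>i\<le>?n. u i *\<^sub>R (v ^ i * h)) = 0" "\<exists>i\<le>?n. u i \<noteq> 0"
      using linear_relation_in_finite_span[of "T ` carrier G" ?n "\<lambda>i. v ^ i * h"] fin by auto
    define p where "p = (\<Sum>i\<le>?n. monom (u i) i)"
    have "coeff p i = u i" if "i \<le> ?n" for i
      using that by (simp add: p_def coeff_sum)
    then have "p \<noteq> 0" using u(2) by auto
    moreover have "peval p v * h = 0"
      using u(1) by (simp add: p_def peval_sum peval_monom sum_distrib_right)
    ultimately show ?thesis by (auto simp: P_def)
  qed
  then obtain p where p: "P p" "\<And>q. P q \<Longrightarrow> degree p \<le> degree q"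
    using ex_has_least_nat[of P _ degree] by blast
  have smaller: "peval q v * h \<noteq> 0" "q \<noteq> 0" if "p = s * q" "degree s > 0" for s q
  proof -
    show "q \<noteq> 0" using that p(1) by (auto simp: P_def)
    moreover have "degree q < degree p" using that p(1) by (auto simp: P_def degree_mult_eq)
    ultimately show "peval q v * h \<noteq> 0" using p(2)[of q] by (auto simp: P_def)
  qed
  have "degree p \<noteq> 0"
  proof
    assume "degree p = 0"
    then obtain c where "p = [:c:]" by (rule degree_eq_zeroE)
    then show False using p(1) h by (simp add: P_def)
  qed
  then have "degree (map_poly complex_of_real p) \<noteq> 0" by simp
  then have "\<not> constant (poly (map_poly complex_of_real p))" by (simp add: constant_degree)
  then obtain z :: complex where "poly (map_poly complex_of_real p) z = 0"
    using fundamental_theorem_of_algebra by blast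
  then have z: "peval p z = 0" by (simp only: poly_map_complex)
  have "Im z = 0"
  proof (rule ccontr)
    assume im: "Im z \<noteq> 0"
    let ?s = "[:(Re z)\<^sup>2 + (Im z)\<^sup>2, - 2 * Re z, 1:]"
    obtain q where q: "p = ?s * q" using nonreal_root_quadratic_dvd[OF z im] by (auto elim: dvdE)
    define x where "x = peval (q * d) v"
    have x0: "x \<noteq> 0" using smaller(1)[OF q] by (simp add: x_def peval_mult h_def)
    define y where "y = peval ([:- Re z, 1:] * (q * d)) v"
    have yx: "y \<in> group_alg" "star y = y" "x \<in> group_alg" "star x = x"
      using v by (simp_all add: x_def y_def star_peval peval_in_group_alg)
    have s: "?s = [:- Re z, 1:] * [:- Re z, 1:] + [:(Im z)\<^sup>2:]"
      by (simp add: power2_eq_square)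
    have "y * y + (Im z)\<^sup>2 *\<^sub>R (x * x) = peval (([:- Re z, 1:] * (q * d)) * ([:- Re z, 1:] * (q * d)) + [:(Im z)\<^sup>2:] * ((q * d) * (q * d))) v"
      unfolding x_def y_def peval_add by (simp only: peval_mult) (simp add: algebra_simps)
    also have "([:- Re z, 1:] * (q * d)) * ([:- Re z, 1:] * (q * d)) + [:(Im z)\<^sup>2:] * ((q * d) * (q * d)) =
      (p * d) * (q * d)"
      unfolding q s by (simp only: algebra_simps)
    also have "peval \<dots> v = 0" using p(1) by (simp add: peval_mult P_def flip: h_def)
    finally have "coef \<one> (y * star y + (Im z)\<^sup>2 *\<^sub>R (x * star x)) = coef \<one> 0"
      using yx by simp
    then have "coef \<one> (y * star y) + (Im z)\<^sup>2 * coef \<one> (x * star x) = 0"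
      by (simp only: coef_simps)
    moreover have "coef \<one> (y * star y) \<ge> 0" 
      using yx by (subst coef_one_mult_star) (auto intro: sum_nonneg)
    ultimately have "(Im z)\<^sup>2 * coef \<one> (x * star x) \<le> 0" by linarith
    then have "coef \<one> (x * star x) \<le> 0" using im by (simp add: mult_le_0_iff)
    then show False using coef_one_mult_star_eq_0[OF yx(3)] x0 by simp
  qed
  define r where "r = Re z"
  have "z = complex_of_real r" using \<open>Im z = 0\<close> by (simp add: r_def complex_eq_iff)
  then have "poly p r = 0" 
    using z poly_map_complex[of p z] by (simp add: of_real_hom.poly_map_poly)
  then obtain q where q: "p = [:- r, 1:] * q" by (auto simp: poly_eq_0_iff_dvd elim: dvdE)
  define x where "x = peval (q * d) v"
  have x0: "x \<noteq> 0" using smaller(1)[OF q] by (simp add: x_def peval_mult h_def)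
  have x: "x \<in> group_alg" "star x = x"
    using v by (simp_all add: x_def star_peval peval_in_group_alg)
  have "peval [:- r, 1:] v * x = peval p v * h" unfolding q x_def by (simp only: peval_mult h_def mult.assoc)
  then have vx: "v * x = r *\<^sub>R x" using p(1) by (simp add: P_def algebra_simps)
  define c where "c = poly (q * d) r"
  have xx: "x * x = c *\<^sub>R x" 
    using peval_eigenvector[OF vx, of "q * d"] by (simp add: c_def x_def)
  have "x * x \<noteq> 0" using coef_one_mult_star_eq_0[OF x(1)] x(2) x0 by auto
  then have c0: "c \<noteq> 0" using xx by auto
  then have "r\<^sup>2 \<noteq> 1" by (auto simp: c_def d_def power2_eq_square)
  moreover have "peval (smult (1 / c) (q * d)) v = (1 / c) *\<^sub>R x" by (simp only: peval_smult x_def)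
  ultimately show ?thesis
    using c0 x0 xx vx by (intro that[of "smult (1 / c) (q * d)" r]) simp_all
qed

end

section \<open>If every g^2 is conjugate to the inverse of g, central units are trivial\<close>

context fin_group
begin

text \<open>
  The hypothesis says that \<open>g\<close> is conjugate to its power with exponent -2, which is 7 modulo 9. Powers of this
  exponent reach every residue that is 1 modulo 3, and for \<open>k\<close> congruent to 2 modulo 3 the residue of
  \<open>- k\<close> is reached instead.
\<close>

lemma conj_to_pow:
  assumes sq: "\<exists>x\<in>carrier G. inv x \<otimes> g [^] (2 :: nat) \<otimes> x = inv g"
    and g: "g \<in> carrier G" and ord: "ord g = 3 ^ e" and k: "\<not> 3 dvd (k :: nat)"
  obtains x where "x \<in> carrier G" "inv x \<otimes> g \<otimes> x = g [^] k \<or> inv x \<otimes> g \<otimes> x = inv (g [^] k)"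
proof -
  obtain x where x: "x \<in> carrier G" "inv x \<otimes> g [^] (2 :: nat) \<otimes> x = inv g" using sq by auto
  \<comment> \<open>a multiple of 9 and of the order of \<open>g\<close>, so that \<open>n - 2\<close> is 7 modulo 9 and acts as -2\<close>
  define n where "n = 9 * ord g"
  have "ord g \<ge> 1" by (simp add: ord)
  then have n: "n \<ge> 2" "n mod 9 = 0" "ord g dvd n" by (auto simp: n_def)
  have gn: "g [^] n = \<one>" using n(3) pow_eq_id[OF g] by simp
  have inv_pow: "inv (g [^] i) = g [^] j" if "n dvd j + i" for i j :: nat
  proof -
    have "g [^] j \<otimes> g [^] i = g [^] (j + i)" using g by (rule nat_pow_mult)
    also have "\<dots> = \<one>" using that pow_eq_id[OF g] n(3) by (metis dvd_trans)
    finally show ?thesis using g by (simp add: inv_equality)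
  qed
  have "inv (inv x) \<otimes> g \<otimes> inv x = inv (g [^] (2 :: nat))"
  proof -
    have "inv (inv x) \<otimes> g \<otimes> inv x = x \<otimes> inv (inv x \<otimes> g [^] (2 :: nat) \<otimes> x) \<otimes> inv x"
      using x g by simp
    also have "inv (inv x \<otimes> g [^] (2 :: nat) \<otimes> x) = inv x \<otimes> inv (g [^] (2 :: nat)) \<otimes> x"
      using x(1) g by (simp add: inv_mult_group m_assoc)
    finally show ?thesis using x(1) g by (simp add: conj_inverse_cancel)
  qed
  then have step: "inv (inv x) \<otimes> g \<otimes> inv x = g [^] (n - 2)" using inv_pow[of "n - 2" 2] n(1) by (simp del: add_2_eq_Suc')
  have "(int n - 2) mod 9 = 7"
  proof -
    have "int n mod 9 = 0" using n(2) by presburger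
    then show ?thesis by presburger
  qed
  then have n7: "int (n - 2) mod 9 \<in> {4, 7}" using n(1) by (simp add: of_nat_diff)
  have to_pow: "\<exists>x\<in>carrier G. inv x \<otimes> g \<otimes> x = g [^] a" if a: "a mod 3 = 1" for a :: nat
  proof -
    have "int a mod 3 = 1" using a by presburger
    then obtain i where "[int (n - 2) ^ i = int a] (mod 3 ^ e)"
      using pow_surj_mod_three_power[OF n7] by auto
    then have "[int ((n - 2) ^ i) = int a] (mod int (ord g))" by (simp add: ord)
    then have "[(n - 2) ^ i = a] (mod ord g)" by (simp only: cong_int_iff)
    then have "g [^] ((n - 2) ^ i) = g [^] a" using g by (intro pow_cong) simp_all
    then show ?thesis
      using conj_pow_iterate[OF inv_closed[OF x(1)] g step, of i] x(1) by (metis inv_closed nat_pow_closed)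
  qed
  have "k mod 3 = 1 \<or> k mod 3 = 2" using k by presburger
  then consider "k mod 3 = 1" | "k mod 3 = 2" by blast
  then show ?thesis
  proof cases
    case 1
    then show ?thesis using to_pow that by blast
  next
    case 2
    have "k \<le> n * k" using n(1) by simp
    then have eq: "(n * k - k) + k = n * k" by simp
    have "3 dvd n" using n(2) by presburger
    then have "(n * k) mod 3 = 0" by simp
    then have sum3: "((n * k - k) + k) mod 3 = 0" unfolding eq .
    have "c mod 3 = 1" if "(c + k) mod 3 = 0" for c :: nat using that 2 by presburger
    from this[OF sum3] have "(n * k - k) mod 3 = 1" .
    then obtain x where "x \<in> carrier G" "inv x \<otimes> g \<otimes> x = g [^] (n * k - k)" using to_pow by blast
    then show ?thesis using that inv_pow[of "n * k - k" k] eq by simp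
  qed
qed

text \<open>
  With \<open>E\<close> the average of the cyclic group \<open>\<langle>g\<rangle>\<close>, the product \<open>a * E\<close> is idempotent because \<open>a\<close> is central, so its
  coefficient at the identity is rational; this coefficient is the average of the coefficients of \<open>a\<close>
  over \<open>\<langle>g\<rangle>\<close>. The elements \<open>g ^ k\<close> with \<open>k\<close> divisible by 3 have smaller order and are covered by induction. The other
  ones are conjugate to \<open>g\<close> or its inverse, so \<open>a\<close> takes the same value at all of them.
\<close>

lemma coef_idempotent_Rats:
  assumes order: "order G = 3 ^ m"
    and sq: "\<And>g. g \<in> carrier G \<Longrightarrow> \<exists>x\<in>carrier G. inv x \<otimes> g [^] (2 :: nat) \<otimes> x = inv g"
    and e: "a \<in> group_alg" "a * a = a" "star a = a" "\<And>x. x \<in> carrier G \<Longrightarrow> conj_by x a = a"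
    and g: "g \<in> carrier G"
  shows "coef g a \<in> \<rat>"
  using g
proof (induction "ord g" arbitrary: g rule: less_induct)
  case less
  define n where "n = ord g"
  have g: "g \<in> carrier G" by fact
  have gn: "g [^] n = \<one>" using g by (simp add: n_def)
  have "n dvd 3 ^ m" using ord_dvd_group_order[OF g] order by (simp add: n_def)
  moreover have "prime (3 :: nat)" by simp
  ultimately obtain t where t: "n = 3 ^ t" by (auto simp: divides_primepow_nat)
  have n0: "n > 0" by (simp add: t)
  define S where "S = (\<Sum>k<n. T (g [^] k))"
  have S: "S \<in> group_alg" using g by (simp add: S_def)
  have TS: "T (g [^] j) * S = S" for j :: nat
  proof (induction j)
    case (Suc j)
    have "T g * S = (\<Sum>k<n. T (g [^] Suc k))"
      using g by (simp add: S_def sum_distrib_left T_mult T_pow power_commutes)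
    also have "\<dots> = (\<Sum>k\<in>{1..n}. T (g [^] k))"
      by (rule sum.reindex_bij_witness[of _ "\<lambda>k. k - 1" Suc]) auto
    also have "{1..n} = insert n {1..<n}" using n0 by auto
    also have "(\<Sum>k\<in>insert n {1..<n}. T (g [^] k)) = (\<Sum>k\<in>insert 0 {1..<n}. T (g [^] k))"
      using gn by (simp add: T_one)
    also have "insert 0 {1..<n} = {..<n}" using n0 by auto
    finally have "T g * S = S" by (simp add: S_def)
    then show ?case using g Suc by (simp add: T_mult mult.assoc)
  qed (simp add: T_one)
  \<comment> \<open>the idempotent that projects onto the vectors fixed by \<open>\<langle>g\<rangle>\<close>\<close>
  define E where "E = (1 / real n) *\<^sub>R S"
  have "S * S = real n *\<^sub>R S"
  proof -
    have "S * S = (\<Sum>k<n. T (g [^] k) * S)" by (subst (1) S_def) (simp add: sum_distrib_right)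
    then show ?thesis by (simp add: TS scaleR_conv_of_real)
  qed
  then have E: "E \<in> group_alg" "E * E = E" using S n0 by (simp_all add: E_def)
  have aT: "T x * a = a * T x" if "x \<in> carrier G" for x using e(4)[OF that] that by (simp add: conj_eq_iff)
  then have "E * a = a * E"
    using g by (simp add: E_def S_def sum_distrib_left sum_distrib_right)
  then have "(a * E) * (a * E) = a * E" by (metis E(2) e(2) mult.assoc)
  from idempotent_coef_one[OF _ this] have "real (order G) * coef \<one> (a * E) \<in> \<int>" using e E by simp
  then have "real (order G) * coef \<one> (a * E) \<in> \<rat>" using Ints_subset_Rats by blast
  moreover have "coef \<one> (a * E) = (1 / real n) * (\<Sum>k<n. coef (g [^] k) a)"
  proof -
    have "coef \<one> (a * T z) = coef z a" if z: "z \<in> carrier G" for z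
      using coef_star[of z a] z e by (simp add: coef_mult_T)
    then show ?thesis using g by (simp add: E_def S_def sum_distrib_left)
  qed
  ultimately have "real (order G) * ((1 / real n) * (\<Sum>k<n. coef (g [^] k) a)) \<in> \<rat>" by simp
  then have "(real n / real (order G)) * (real (order G) * ((1 / real n) * (\<Sum>k<n. coef (g [^] k) a))) \<in> \<rat>"
    by (rule Rats_mult[OF Rats_divide[OF Rats_of_nat Rats_of_nat]])
  moreover have "(real n / real (order G)) * (real (order G) * ((1 / real n) * (\<Sum>k<n. coef (g [^] k) a))) =
    (\<Sum>k<n. coef (g [^] k) a)" using n0 order by simp
  ultimately have sum: "(\<Sum>k<n. coef (g [^] k) a) \<in> \<rat>" by simp
  show ?case
  proof (cases "t = 0")
    case True
    then have n1: "n = 1" by (simp add: t)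
    then have "g = \<one>" using gn g by simp
    then show ?thesis using sum by (simp add: n1)
  next
    case False
    let ?A = "{k\<in>{..<n}. 3 dvd k}" and ?B = "{k\<in>{..<n}. \<not> 3 dvd k}"
    have "coef (g [^] k) a \<in> \<rat>" if k3: "3 dvd k" for k :: nat
    proof -
      obtain l where l: "k = 3 * l" using k3 by blast
      define n' where "n' = (3 :: nat) ^ (t - 1)"
      have n': "n = 3 * n'" using False by (cases t) (simp_all add: t n'_def)
      have "k * n' = n * l" by (simp add: l n')
      then have "(g [^] k) [^] n' = \<one>" using g gn by (simp add: nat_pow_pow pow_mult_one)
      then have "ord (g [^] k) dvd n'" using pow_eq_id[of "g [^] k" n'] g by simp
      then have "ord (g [^] k) < n" using n' n0 by (auto dest: dvd_imp_le)
      then show ?thesis using less.hyps[of "g [^] k"] g by (simp add: n_def)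
    qed
    then have "(\<Sum>k\<in>?A. coef (g [^] k) a) \<in> \<rat>" by (intro Rats_sum) auto
    moreover have "(\<Sum>k<n. coef (g [^] k) a) = (\<Sum>k\<in>?A. coef (g [^] k) a) + (\<Sum>k\<in>?B. coef (g [^] k) a)"
    proof -
      have "{..<n} = ?A \<union> ?B" by auto
      moreover have "(\<Sum>k\<in>?A \<union> ?B. coef (g [^] k) a) = (\<Sum>k\<in>?A. coef (g [^] k) a) + (\<Sum>k\<in>?B. coef (g [^] k) a)"
        by (rule sum.union_disjoint) auto
      ultimately show ?thesis by (rule ssubst)
    qed
    ultimately have "(\<Sum>k<n. coef (g [^] k) a) - (\<Sum>k\<in>?A. coef (g [^] k) a) = (\<Sum>k\<in>?B. coef (g [^] k) a)"
      "(\<Sum>k\<in>?A. coef (g [^] k) a) \<in> \<rat>" by linarith+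
    from this(1) Rats_diff[OF sum this(2)] have "(\<Sum>k\<in>?B. coef (g [^] k) a) \<in> \<rat>" by (rule subst)
    moreover have "coef (g [^] k) a = coef g a" if k: "\<not> 3 dvd k" for k :: nat
    proof -
      obtain x where x: "x \<in> carrier G" 
        "inv x \<otimes> g \<otimes> x = g [^] k \<or> inv x \<otimes> g \<otimes> x = inv (g [^] k)"
        using conj_to_pow[OF sq[OF g] g t[unfolded n_def] k] .
      have "coef g a = coef (inv x \<otimes> g \<otimes> x) a"
        using coef_conj[OF x(1) g e(1)] e(4)[OF x(1)] by simp
      moreover have "coef (inv (g [^] k)) a = coef (g [^] k) a"
        using coef_star[of "g [^] k" a] e(3) g by simp
      ultimately show ?thesis using x(2) by auto
    qed
    ultimately have "real (card ?B) * coef g a \<in> \<rat>" by simp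
    moreover have "card ?B \<noteq> 0"
    proof -
      have "1 < n" using False unfolding t by (intro one_less_power) simp_all
      then have "1 \<in> ?B" by simp
      moreover have "finite ?B" by simp
      ultimately show ?thesis by (metis card_0_eq emptyE)
    qed
    moreover have "real (card ?B) * coef g a / real (card ?B) = coef g a"
      using \<open>card ?B \<noteq> 0\<close> by simp
    ultimately show ?thesis 
      using Rats_divide[of "real (card ?B) * coef g a" "real (card ?B)"] by simp
  qed
qed

text \<open>
  For an integral multiple \<open>b\<close> of \<open>a\<close> with a nonzero coefficient \<open>d\<close>, all \<open>r ^ k * d\<close> are coefficients of
  \<open>v ^ k * b\<close>, hence nonzero integers; for \<open>\<bar>r\<bar> < 1\<close> they would tend to 0.
\<close>

lemma eigenvalue_ge_one:
  assumes v: "v \<in> int_group_alg" "w * v = 1" and a: "a \<in> group_alg" "a \<noteq> 0" 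
    "\<And>x. x \<in> carrier G \<Longrightarrow> coef x a \<in> \<rat>" and va: "v * a = r *\<^sub>R a"
  shows "\<bar>r\<bar> \<ge> 1"
proof (rule ccontr)
  assume "\<not> \<bar>r\<bar> \<ge> 1"
  then have r: "\<bar>r\<bar> < 1" by simp
  have "r \<noteq> 0"
  proof
    assume "r = 0"
    then have "w * (v * a) = 0" using va by simp
    then show False using v(2) a(2) by (simp flip: mult.assoc)
  qed
  obtain D :: nat where D: "D > 0" "\<And>x. x \<in> carrier G \<Longrightarrow> real D * coef x a \<in> \<int>"
    by (rule common_denominator[OF fin, of "\<lambda>x. coef x a"]) (use a(3) in auto)
  define b where "b = real D *\<^sub>R a"
  have b: "b \<in> int_group_alg" using a D by (simp add: b_def int_group_alg_def)
  have "b \<noteq> 0" using D a(2) by (simp add: b_def)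
  then obtain x where x: "x \<in> carrier G" "coef x b \<noteq> 0"
    using group_alg_eqI[of b 0] int_group_alg_D(1)[OF b] by auto
  have pow: "v ^ k * b = r ^ k *\<^sub>R b" for k
  proof (induction k)
    case (Suc k)
    have "v ^ Suc k * b = v * (v ^ k * b)" by (simp add: mult.assoc)
    also have "\<dots> = r ^ k *\<^sub>R (v * b)" by (simp add: Suc)
    also have "v * b = r *\<^sub>R b" by (simp add: b_def va)
    finally show ?case by simp
  qed simp
  have "\<bar>r ^ k * coef x b\<bar> \<ge> 1" for k
  proof -
    have "v ^ k * b \<in> int_group_alg" using v b by simp
    then have "r ^ k * coef x b \<in> \<int>" using int_group_alg_D(2) x(1) by (metis coef_simps(4) pow)
    then show ?thesis using x(2) \<open>r \<noteq> 0\<close> by (intro Ints_nonzero_abs_ge1) auto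
  qed
  moreover have "(\<lambda>k. \<bar>r ^ k * coef x b\<bar>) \<longlonglongrightarrow> 0"
    using r by (intro tendsto_rabs_zero tendsto_mult_left_zero LIMSEQ_power_zero) simp
  then have "eventually (\<lambda>k. \<bar>r ^ k * coef x b\<bar> < 1) sequentially"
    by (rule order_tendstoD) simp
  ultimately show False using eventually_happens'[OF sequentially_bot] by (metis not_le)
qed

text \<open>
  A sum of squares of integers equals 1 only if exactly one of them is nonzero.
\<close>

lemma int_norm_one:
  assumes a: "a \<in> int_group_alg" "coef \<one> (a * star a) = 1"
  obtains z where "z \<in> carrier G" "a = T z \<or> a = - T z"
proof -
  have sum: "(\<Sum>x\<in>carrier G. (coef x a)\<^sup>2) = 1"
    using coef_one_mult_star[of a] a int_group_alg_D(1) by simp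
  then obtain z where z: "z \<in> carrier G" "coef z a \<noteq> 0"
    by (metis (no_types, lifting) sum.neutral zero_neq_one power_zero_numeral)
  have "\<bar>coef z a\<bar> \<ge> 1" using z a(1) int_group_alg_D(2) by (intro Ints_nonzero_abs_ge1) auto
  then have z1: "(coef z a)\<^sup>2 \<ge> 1" by (simp add: abs_le_square_iff[of 1, simplified])
  have "(\<Sum>x\<in>carrier G. (coef x a)\<^sup>2) = (coef z a)\<^sup>2 + (\<Sum>x\<in>carrier G - {z}. (coef x a)\<^sup>2)"
    using fin z(1) by (rule sum.remove)
  moreover have "(\<Sum>x\<in>carrier G - {z}. (coef x a)\<^sup>2) \<ge> 0" by (intro sum_nonneg) simp
  ultimately have "(coef z a)\<^sup>2 = 1" "(\<Sum>x\<in>carrier G - {z}. (coef x a)\<^sup>2) = 0" using z1 sum by linarith+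
  then have other: "coef x a = 0" if "x \<in> carrier G" "x \<noteq> z" for x
    using that fin by (simp add: sum_nonneg_eq_0_iff)
  have "coef z a = 1 \<or> coef z a = - 1" using \<open>(coef z a)\<^sup>2 = 1\<close> by (simp add: power2_eq_1_iff)
  moreover have "a = coef z a *\<^sub>R T z"
  proof (rule group_alg_eqI)
    fix x assume "x \<in> carrier G"
    then show "coef x a = coef x (coef z a *\<^sub>R T z)"
      using other z(1) by (cases "x = z") (simp_all add: coef_T)
  qed (use int_group_alg_D(1)[OF a(1)] z(1) in simp_all)
  ultimately have "a = T z \<or> a = - T z" by (metis scaleR_one scaleR_minus1_left)
  then show ?thesis using that z(1) by blast
qed

text \<open>
  For a central unit \<open>u\<close>, the element \<open>w = inverse u * star u\<close> satisfies \<open>w * star w = 1\<close>, so it is \<open>z\<close> or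
  \<open>- z\<close> for a group element \<open>z\<close>, and the sum of coefficients excludes the sign. As the order is odd,
  \<open>z = y\<^sup>2\<close> for a power \<open>y\<close> of \<open>z\<close>, and \<open>v = u * y\<close> is self-adjoint. An idempotent
  eigenvector of \<open>v\<close> has rational coefficients; comparing \<open>v\<close> and its inverse, its eigenvalue has absolute value
  1. Hence \<open>v\<^sup>2 = 1\<close>, and \<open>v * star v = 1\<close> shows that \<open>v\<close> is trivial.
\<close>

lemma trivial_central_units_if_square_conj_inverse:
  assumes order: "order G = 3 ^ m"
    and sq: "\<And>g. g \<in> carrier G \<Longrightarrow> \<exists>x\<in>carrier G. inv x \<otimes> g [^] (2 :: nat) \<otimes> x = inv g"
  shows trivial_central_units
  unfolding trivial_central_units_def
proof (intro ballI impI)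
  fix u u' assume u: "u \<in> int_group_alg" "u' \<in> int_group_alg"
    and "u * u' = 1 \<and> u' * u = 1 \<and> (\<forall>x\<in>carrier G. conj_by x u = u)"
  then have inv: "u * u' = 1" "u' * u = 1" and "\<And>x. x \<in> carrier G \<Longrightarrow> conj_by x u = u" by auto
  then have uT: "T x * u = u * T x" if "x \<in> carrier G" for x using that by (metis conj_eq_iff)
  note alg = int_group_alg_D(1)[OF u(1)] int_group_alg_D(1)[OF u(2)]
  have u'T: "T x * u' = u' * T x" if "x \<in> carrier G" for x
  proof -
    have "u' * (T x * u) * u' = u' * (u * T x) * u'" using uT[OF that] by simp
    then show ?thesis using inv by (simp add: mult.assoc) (simp flip: mult.assoc add: inv)
  qed
  have suT: "T x * star u = star u * T x" if "x \<in> carrier G" for x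
    using arg_cong[OF uT[of "inv x"], of star] that alg by (simp add: star_mult star_T)
  have comm: "b * u = u * b" if "b \<in> group_alg" for b
    by (subst (1 2) group_alg_expand[OF that]) (simp add: sum_distrib_left sum_distrib_right uT)
  define w where "w = u' * star u"
  have "w * star w = u' * (star u * u) * star u'"
    using alg by (simp add: w_def star_mult mult.assoc)
  also have "star u * u = u * star u" by (rule comm) simp
  also have "u' * (u * star u) * star u' = (u' * u) * (star u * star u')" by (simp only: mult.assoc)
  also have "\<dots> = star (u' * u)" using star_mult[OF alg(2,1)] by (simp add: inv(2))
  also have "\<dots> = 1" by (simp add: inv)
  finally have "w * star w = 1" .
  moreover have "w \<in> int_group_alg" using u by (simp add: w_def)
  moreover have "coef \<one> 1 = 1" using coef_T[OF one_closed one_closed] by (simp add: T_one)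
  ultimately obtain z where z: "z \<in> carrier G" "w = T z \<or> w = - T z"
    using int_norm_one[of w] by auto
  have su: "star u = u * w" by (simp add: w_def inv flip: mult.assoc)
  have zc: "x \<otimes> z = z \<otimes> x" if x: "x \<in> carrier G" for x
  proof -
    have "T x * w = w * T x" using x u'T suT by (simp add: w_def) (metis mult.assoc)
    then have "T (x \<otimes> z) = T (z \<otimes> x)" using z x by (auto simp: T_mult)
    then show ?thesis using coef_T[of "x \<otimes> z" "z \<otimes> x"] coef_T[of "z \<otimes> x" "z \<otimes> x"] x z 
      by (simp split: if_splits)
  qed
  define aug where "aug b = (\<Sum>x\<in>carrier G. coef x b)" for b
  have aug_star: "aug (star b) = aug b" for b
    unfolding aug_def
    by (rule sum.reindex_bij_witness[of _ "\<lambda>x. inv x" "\<lambda>x. inv x"]) (simp_all add: coef_star)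
  have aug_mult: "aug (b * c) = aug b * aug c" if "b \<in> group_alg" "c \<in> group_alg" for b c
  proof -
    have "aug (b * c) = (\<Sum>x\<in>carrier G. \<Sum>y\<in>carrier G. coef y b * coef (inv y \<otimes> x) c)"
      using that by (simp add: aug_def coef_mult)
    also have "\<dots> = (\<Sum>y\<in>carrier G. \<Sum>x\<in>carrier G. coef y b * coef (inv y \<otimes> x) c)" by (rule sum.swap)
    also have "\<dots> = (\<Sum>y\<in>carrier G. \<Sum>x\<in>carrier G. coef y b * coef x c)"
    proof (rule sum.cong[OF refl])
      fix y assume y: "y \<in> carrier G"
      show "(\<Sum>x\<in>carrier G. coef y b * coef (inv y \<otimes> x) c) = (\<Sum>x\<in>carrier G. coef y b * coef x c)"
        by (rule sum.reindex_bij_witness[of _ "\<lambda>x. y \<otimes> x" "\<lambda>x. inv y \<otimes> x"])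
          (use y in \<open>auto simp flip: m_assoc\<close>)
    qed
    finally show ?thesis by (simp add: aug_def sum_product)
  qed
  have aug_T: "aug (T x) = 1" if "x \<in> carrier G" for x
    using that fin by (simp add: aug_def coef_T)
  have "aug u * aug u' = 1" using aug_mult[OF alg] aug_T[OF one_closed] by (simp add: inv T_one)
  then have "aug u \<noteq> 0" by auto
  moreover have "aug u = aug u * aug w" using aug_star[of u] aug_mult[OF alg(1), of w] z(1) z(2) by (auto simp: su)
  ultimately have "aug w = 1" by simp
  moreover have "aug (- T z) = - 1" using aug_T[OF z(1)] by (simp add: aug_def sum_negf)
  ultimately have wz: "w = T z" using z(2) by auto
  \<comment> \<open>a square root of \<open>z\<close>, as the order of the group is odd\<close>
  define y where "y = z [^] ((order G + 1) div 2)"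
  have y: "y \<in> carrier G" using z(1) by (simp add: y_def)
  have yy: "y \<otimes> y = z"
  proof -
    have "odd (order G)" by (simp add: order)
    then have "(order G + 1) div 2 + (order G + 1) div 2 = order G + 1" by presburger
    then have "y \<otimes> y = z [^] (order G + 1)" using z(1) by (simp add: y_def nat_pow_mult)
    then show ?thesis using z(1) pow_order_eq_1[OF z(1)] by simp
  qed
  have yc: "x \<otimes> y = y \<otimes> x" if x: "x \<in> carrier G" for x
  proof -
    have "x \<otimes> z [^] k = z [^] k \<otimes> x" for k :: nat
    proof (induction k)
      case (Suc k)
      have "x \<otimes> (z [^] k \<otimes> z) = (x \<otimes> z [^] k) \<otimes> z" using x z(1) by (simp add: m_assoc)
      also have "\<dots> = z [^] k \<otimes> (x \<otimes> z)" using x z(1) by (simp only: Suc m_assoc nat_pow_closed)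
      also have "\<dots> = z [^] k \<otimes> z \<otimes> x" using x z(1) by (simp add: zc[OF x] m_assoc)
      finally show ?case by (simp only: nat_pow_Suc)
    qed (use x in simp)
    then show ?thesis by (simp add: y_def)
  qed
  define v where "v = u * T y"
  have v_int: "v \<in> int_group_alg" using u y by (simp add: v_def)
  have v_alg: "v \<in> group_alg" by (rule int_group_alg_D(1)[OF v_int])
  have "star v = T (inv y) * (u * T (y \<otimes> y))"
    using alg y by (simp add: v_def star_mult star_T su wz yy)
  also have "\<dots> = u * (T (inv y) * T (y \<otimes> y))" using uT[of "inv y"] y by (simp flip: mult.assoc)
  also have "\<dots> = v" using y by (simp add: v_def T_mult)
  finally have v_star: "star v = v" .
  have vT: "conj_by x v = v" if x: "x \<in> carrier G" for x
  proof -
    have "T x * v = u * T (x \<otimes> y)" using uT[OF x] x y by (simp add: v_def T_mult flip: mult.assoc)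
    also have "\<dots> = v * T x" using x y by (simp add: v_def yc T_mult mult.assoc)
    finally show ?thesis using x by (simp add: conj_eq_iff)
  qed
  define v' where "v' = T (inv y) * u'"
  have v': "v' \<in> int_group_alg" "v' * v = 1" "v * v' = 1"
  proof -
    have "v' * v = T (inv y) * (u' * u) * T y" by (simp add: v'_def v_def mult.assoc)
    then show "v' * v = 1" using y by (simp add: inv)
    have "v * v' = u * (T y * T (inv y)) * u'" by (simp only: v'_def v_def mult.assoc)
    then show "v * v' = 1" using y by (simp add: inv)
  qed (use u y in \<open>simp add: v'_def\<close>)
  have "v * v = 1"
  proof (rule ccontr)
    assume "v * v \<noteq> 1"
    then obtain q r where q: "peval q v \<noteq> 0" "peval q v * peval q v = peval q v"
      "v * peval q v = r *\<^sub>R peval q v" "r\<^sup>2 \<noteq> (1 :: real)"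
      using self_adjoint_eigen_idempotent[OF v_alg v_star] by blast
    let ?a = "peval q v"
    have a: "?a \<in> group_alg" "star ?a = ?a" using v_alg v_star by (simp_all add: peval_in_group_alg star_peval)
    have "T x * ?a = ?a * T x" if "x \<in> carrier G" for x
    proof (induction q)
      case (pCons c q)
      have "T x * v = v * T x" using vT[OF that] that by (simp add: conj_eq_iff)
      then have "T x * (v * peval q v) = v * (peval q v * T x)" using pCons by (metis mult.assoc)
      then show ?case by (simp add: algebra_simps)
    qed simp
    then have conj_a: "conj_by x ?a = ?a" if "x \<in> carrier G" for x using that by (simp add: conj_eq_iff)
    have rat: "coef x ?a \<in> \<rat>" if "x \<in> carrier G" for x
      by (rule coef_idempotent_Rats[OF order sq a(1) q(2) a(2) conj_a that])
    have "\<bar>r\<bar> \<ge> 1" by (rule eigenvalue_ge_one[OF v_int v'(2) a(1) q(1) rat q(3)])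
    then have r0: "r \<noteq> 0" by auto
    have "v' * (v * ?a) = r *\<^sub>R (v' * ?a)" by (simp add: q(3))
    then have "?a = r *\<^sub>R (v' * ?a)" by (simp add: v'(2) flip: mult.assoc)
    then have "(1 / r) *\<^sub>R ?a = (1 / r) *\<^sub>R (r *\<^sub>R (v' * ?a))" by (rule arg_cong)
    then have v'a: "v' * ?a = (1 / r) *\<^sub>R ?a" using r0 by simp
    have "\<bar>1 / r\<bar> \<ge> 1" by (rule eigenvalue_ge_one[OF v'(1,3) a(1) q(1) rat v'a])
    then have "\<bar>r\<bar> = 1" using \<open>\<bar>r\<bar> \<ge> 1\<close> r0 by (simp add: field_simps)
    then show False using q(4) by (metis power2_abs one_power2)
  qed
  then obtain z' where z': "z' \<in> carrier G" "v = T z' \<or> v = - T z'"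
    using int_norm_one[OF v_int] v_star \<open>coef \<one> 1 = 1\<close> by metis
  have "u = v * T (inv y)" using y by (simp add: v_def mult.assoc)
  then have "u = T (z' \<otimes> inv y) \<or> u = - T (z' \<otimes> inv y)" using z' y by (auto simp: T_mult)
  then show "\<exists>z\<in>carrier G. u = T z \<or> u = - T z" using z'(1) y by blast
qed

end

section \<open>The cut property of 3-groups and of their products\<close>

context fin_group
begin

definition embed :: "('a \<Rightarrow> int) \<Rightarrow> 'a operator" where
  "embed f = (\<Sum>x\<in>carrier G. real_of_int (f x) *\<^sub>R T x)"

lemma embed_in_int_group_alg: "embed f \<in> int_group_alg"
  and coef_embed: "x \<in> carrier G \<Longrightarrow> coef x (embed f) = real_of_int (f x)"
proof -
  have c: "coef x (embed f) = real_of_int (f x)" if "x \<in> carrier G" for x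
  proof -
    have "coef x (embed f) = (\<Sum>y\<in>carrier G. if y = x then real_of_int (f y) else 0)"
      using that by (auto simp: embed_def coef_T intro!: sum.cong)
    then show ?thesis using that fin by simp
  qed
  then show "x \<in> carrier G \<Longrightarrow> coef x (embed f) = real_of_int (f x)" .
  show "embed f \<in> int_group_alg"
    by (simp add: int_group_alg_def c) (simp add: embed_def)
qed

abbreviation ZG where "ZG \<equiv> int_group_ring G"

lemma embed_surj:
  assumes "a \<in> int_group_alg"
  obtains f where "f \<in> carrier ZG" "embed f = a"
proof
  define f where "f x = (if x \<in> carrier G then \<lfloor>coef x a\<rfloor> else 0)" for x
  show "f \<in> carrier ZG" by (simp add: f_def int_group_ring_def)
  show "embed f = a"
    using assms by (intro group_alg_eqI int_group_alg_D(1) embed_in_int_group_alg)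
      (auto simp: coef_embed f_def int_group_alg_def)
qed

lemma embed_inj:
  assumes "f \<in> carrier ZG" "g \<in> carrier ZG" "embed f = embed g"
  shows "f = g"
proof
  fix x
  show "f x = g x"
    using assms coef_embed[of x f] coef_embed[of x g]
    by (cases "x \<in> carrier G") (auto simp: int_group_ring_def)
qed

lemma embed_mult: "embed (f \<otimes>\<^bsub>ZG\<^esub> g) = embed f * embed g"
  using int_group_alg_D(1)[OF embed_in_int_group_alg]
  by (intro group_alg_eqI) (auto simp: coef_embed coef_mult int_group_ring_def)

lemma embed_group_ring_elem: "x \<in> carrier G \<Longrightarrow> embed (group_ring_elem x) = T x"
  using int_group_alg_D(1)[OF embed_in_int_group_alg]
  by (intro group_alg_eqI) (auto simp: coef_embed coef_T group_ring_elem_def)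

lemma group_ring_elem_closed: "x \<in> carrier G \<Longrightarrow> group_ring_elem x \<in> carrier ZG"
  by (auto simp: int_group_ring_def group_ring_elem_def)

lemma embed_one: "embed \<one>\<^bsub>ZG\<^esub> = 1"
  using embed_group_ring_elem[OF one_closed]
  by (simp add: group_ring_elem_def[abs_def] int_group_ring_def T_one)

lemma embed_minus: "f \<in> carrier ZG \<Longrightarrow> embed (\<ominus>\<^bsub>ZG\<^esub> f) = - embed f"
proof -
  interpret R: ring ZG by (rule ring_int_group_ring[OF fin])
  assume f: "f \<in> carrier ZG"
  have add: "embed (f \<oplus>\<^bsub>ZG\<^esub> g) = embed f + embed g" for f g
    by (simp add: embed_def int_group_ring_def scaleR_add_left sum.distrib)
  have "embed \<zero>\<^bsub>ZG\<^esub> = 0" by (simp add: embed_def int_group_ring_def)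
  then have "embed f + embed (\<ominus>\<^bsub>ZG\<^esub> f) = 0" using f by (simp add: R.r_neg flip: add)
  then show ?thesis by (simp add: eq_neg_iff_add_eq_0 add.commute)
qed

lemma in_Units_ZG_iff:
  assumes "f \<in> carrier ZG"
  shows "f \<in> Units ZG \<longleftrightarrow> (\<exists>b\<in>int_group_alg. embed f * b = 1 \<and> b * embed f = 1)"
proof
  assume "f \<in> Units ZG"
  then obtain g where "g \<in> carrier ZG" "g \<otimes>\<^bsub>ZG\<^esub> f = \<one>\<^bsub>ZG\<^esub>" "f \<otimes>\<^bsub>ZG\<^esub> g = \<one>\<^bsub>ZG\<^esub>"
    by (auto simp: Units_def)
  then show "\<exists>b\<in>int_group_alg. embed f * b = 1 \<and> b * embed f = 1"
    by (intro bexI[of _ "embed g"]) (simp_all add: embed_in_int_group_alg embed_one flip: embed_mult)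
next
  assume "\<exists>b\<in>int_group_alg. embed f * b = 1 \<and> b * embed f = 1"
  then obtain b where b: "b \<in> int_group_alg" "embed f * b = 1" "b * embed f = 1" by auto
  interpret R: ring ZG by (rule ring_int_group_ring[OF fin])
  obtain g where g: "g \<in> carrier ZG" "embed g = b" using embed_surj[OF b(1)] .
  have "g \<otimes>\<^bsub>ZG\<^esub> f = \<one>\<^bsub>ZG\<^esub>" "f \<otimes>\<^bsub>ZG\<^esub> g = \<one>\<^bsub>ZG\<^esub>"
    using assms g b by (auto intro!: embed_inj simp: embed_mult embed_one)
  then show "f \<in> Units ZG" using assms g by (auto simp: Units_def)
qed

text \<open>
  Group elements are units, so a central unit commutes with all of them and, by linearity, with the whole ring.
\<close>

lemma central_units_ZG:
  "group_center (units_of ZG) =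
    {f \<in> carrier ZG. (\<exists>b\<in>int_group_alg. embed f * b = 1 \<and> b * embed f = 1) \<and>
       (\<forall>x\<in>carrier G. conj_by x (embed f) = embed f)}"
proof (intro equalityI subsetI)
  fix f assume "f \<in> group_center (units_of ZG)"
  then have f: "f \<in> Units ZG" "\<And>g. g \<in> Units ZG \<Longrightarrow> f \<otimes>\<^bsub>ZG\<^esub> g = g \<otimes>\<^bsub>ZG\<^esub> f"
    by (auto simp: group_center_def units_of_def)
  then have fc: "f \<in> carrier ZG" by (auto simp: Units_def)
  have "conj_by x (embed f) = embed f" if x: "x \<in> carrier G" for x
  proof -
    have "group_ring_elem x \<in> Units ZG"
      unfolding in_Units_ZG_iff[OF group_ring_elem_closed[OF x]] embed_group_ring_elem[OF x]
      by (intro bexI[of _ "T (inv x)"]) (use x in simp_all)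
    then have "embed (f \<otimes>\<^bsub>ZG\<^esub> group_ring_elem x) = embed (group_ring_elem x \<otimes>\<^bsub>ZG\<^esub> f)"
      using f(2) by simp
    then show ?thesis using x by (simp add: embed_mult embed_group_ring_elem conj_eq_iff)
  qed
  then show "f \<in> {f \<in> carrier ZG. (\<exists>b\<in>int_group_alg. embed f * b = 1 \<and> b * embed f = 1) \<and>
       (\<forall>x\<in>carrier G. conj_by x (embed f) = embed f)}"
    using f(1) fc in_Units_ZG_iff by auto
next
  fix f assume f: "f \<in> {f \<in> carrier ZG. (\<exists>b\<in>int_group_alg. embed f * b = 1 \<and> b * embed f = 1) \<and>
       (\<forall>x\<in>carrier G. conj_by x (embed f) = embed f)}"
  interpret R: ring ZG by (rule ring_int_group_ring[OF fin])
  have "f \<otimes>\<^bsub>ZG\<^esub> g = g \<otimes>\<^bsub>ZG\<^esub> f" if g: "g \<in> carrier ZG" for g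
  proof (rule embed_inj)
    have "embed f * embed g = embed g * embed f"
      unfolding embed_def[of g] using f by (simp add: sum_distrib_left sum_distrib_right conj_eq_iff)
    then show "embed (f \<otimes>\<^bsub>ZG\<^esub> g) = embed (g \<otimes>\<^bsub>ZG\<^esub> f)" by (simp add: embed_mult)
  qed (use f g in auto)
  moreover have "f \<in> Units ZG" using f in_Units_ZG_iff by auto
  ultimately show "f \<in> group_center (units_of ZG)"
    by (auto simp: group_center_def units_of_def)
qed

lemma cut_property_iff: "cut_property G \<longleftrightarrow> trivial_central_units"
proof -
  interpret R: ring ZG by (rule ring_int_group_ring[OF fin])
  have T_central: "(\<forall>x\<in>carrier G. conj_by x (T z) = T z) \<longleftrightarrow> z \<in> group_center G" if z: "z \<in> carrier G" for z
  proof -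
    have "conj_by x (T z) = T z \<longleftrightarrow> z \<otimes> x = x \<otimes> z" if x: "x \<in> carrier G" for x
    proof -
      have "T (x \<otimes> z) = T (z \<otimes> x) \<longleftrightarrow> x \<otimes> z = z \<otimes> x"
        using coef_T[of "x \<otimes> z" "z \<otimes> x"] coef_T[of "z \<otimes> x" "z \<otimes> x"] x z by (auto split: if_splits)
      then show ?thesis using x z by (auto simp: conj_eq_iff T_mult)
    qed
    then show ?thesis using z by (auto simp: group_center_def)
  qed
  let ?triv = "\<Union>z\<in>group_center G. {group_ring_elem z, \<ominus>\<^bsub>ZG\<^esub> group_ring_elem z}"
  have sub: "?triv \<subseteq> group_center (units_of ZG)"
  proof
    fix f assume "f \<in> ?triv"
    then obtain z where z: "z \<in> group_center G" 
      and f: "f = group_ring_elem z \<or> f = \<ominus>\<^bsub>ZG\<^esub> group_ring_elem z" by auto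
    have zG: "z \<in> carrier G" using z by (simp add: group_center_def)
    note gz = group_ring_elem_closed[OF zG]
    have e: "f \<in> carrier ZG" "embed f = T z \<or> embed f = - T z"
      using f gz zG by (auto simp: embed_group_ring_elem embed_minus)
    have "\<exists>b\<in>int_group_alg. embed f * b = 1 \<and> b * embed f = 1"
      using e(2) zG by (elim disjE) (auto intro: bexI[of _ "T (inv z)"] bexI[of _ "- T (inv z)"])
    moreover have "\<forall>x\<in>carrier G. conj_by x (embed f) = embed f"
      using e(2) T_central[OF zG] z by (auto simp: conj_linear)
    ultimately show "f \<in> group_center (units_of ZG)" using e(1) by (simp add: central_units_ZG)
  qed
  show ?thesis
  proof
    assume cut: "cut_property G"
    show trivial_central_units
      unfolding trivial_central_units_def
    proof (intro ballI impI)
      fix u v assume u: "u \<in> int_group_alg" "v \<in> int_group_alg"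
        "u * v = 1 \<and> v * u = 1 \<and> (\<forall>x\<in>carrier G. conj_by x u = u)"
      obtain f where f: "f \<in> carrier ZG" "embed f = u" using embed_surj[OF u(1)] .
      then have "f \<in> group_center (units_of ZG)" using u by (auto simp: central_units_ZG)
      then have "f \<in> ?triv" using cut by (simp add: cut_property_def)
      then obtain z where "z \<in> group_center G" 
        and zf: "f = group_ring_elem z \<or> f = \<ominus>\<^bsub>ZG\<^esub> group_ring_elem z" by auto
      then have z: "z \<in> carrier G" by (simp add: group_center_def)
      then have "u = T z \<or> u = - T z"
        using f(2) zf z group_ring_elem_closed[OF z] by (auto simp: embed_group_ring_elem embed_minus)
      then show "\<exists>z\<in>carrier G. u = T z \<or> u = - T z" using z by blast
    qed
  next
    assume triv: trivial_central_units
    have "group_center (units_of ZG) \<subseteq> ?triv"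
    proof
      fix f assume "f \<in> group_center (units_of ZG)"
      then have f: "f \<in> carrier ZG" "\<exists>b\<in>int_group_alg. embed f * b = 1 \<and> b * embed f = 1"
        "\<forall>x\<in>carrier G. conj_by x (embed f) = embed f" by (auto simp: central_units_ZG)
      then obtain z where z: "z \<in> carrier G" "embed f = T z \<or> embed f = - T z"
        using triv embed_in_int_group_alg[of f] unfolding trivial_central_units_def by blast
      have "\<forall>x\<in>carrier G. conj_by x (T z) = T z" using z(2) f(3) by (auto simp: conj_linear)
      then have zc: "z \<in> group_center G" using T_central z(1) by blast
      have "f = group_ring_elem z \<or> f = \<ominus>\<^bsub>ZG\<^esub> group_ring_elem z"
        using z(2)
      proof
        assume "embed f = T z"
        then have "f = group_ring_elem z"
          using f(1) z(1) by (intro embed_inj) (simp_all add: group_ring_elem_closed embed_group_ring_elem)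
        then show ?thesis ..
      next
        assume "embed f = - T z"
        then have "f = \<ominus>\<^bsub>ZG\<^esub> group_ring_elem z"
          using f(1) z(1) 
          by (intro embed_inj) (simp_all add: group_ring_elem_closed embed_group_ring_elem embed_minus)
        then show ?thesis ..
      qed
      then show "f \<in> ?triv" using zc by blast
    qed
    then show "cut_property G" using sub by (auto simp: cut_property_def)
  qed
qed

theorem cut_property_three_group_iff:
  assumes order: "order G = 3 ^ m"
  shows "cut_property G \<longleftrightarrow>
    (\<forall>g\<in>carrier G. \<exists>x\<in>carrier G. inv x \<otimes> g [^] (2 :: nat) \<otimes> x = inv g)"
  unfolding cut_property_iff
  using square_conj_inverse_if_trivial_central_units[OF _ order]
    trivial_central_units_if_square_conj_inverse[OF order] by blast

end

theorem corollary1: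
  fixes H :: "('a, 'm) monoid_scheme" and K :: "('b, 'n) monoid_scheme"
  assumes "group H" and "finite (carrier H)" and "\<exists>m. order H = 3 ^ m"
    and "group K" and "finite (carrier K)" and "\<exists>n. order K = 3 ^ n"
    and "cut_property H" and "cut_property K"
  shows "cut_property (H \<times>\<times> K)"
proof -
  interpret H: fin_group H using assms(1,2) by (simp add: fin_group_def fin_group_axioms_def)
  interpret K: fin_group K using assms(4,5) by (simp add: fin_group_def fin_group_axioms_def)
  interpret HK: group "H \<times>\<times> K" by (rule DirProd_group[OF assms(1,4)])
  interpret HK: fin_group "H \<times>\<times> K"
    by unfold_locales (simp add: DirProd_def H.fin K.fin)
  obtain m n where mn: "order H = 3 ^ m" "order K = 3 ^ n" using assms(3,6) by auto
  have order: "order (H \<times>\<times> K) = 3 ^ (m + n)"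
    using mn by (simp add: Coset.order_def DirProd_def card_cartesian_product power_add)
  have "\<exists>x\<in>carrier (H \<times>\<times> K). inv\<^bsub>H \<times>\<times> K\<^esub> x \<otimes>\<^bsub>H \<times>\<times> K\<^esub> g [^]\<^bsub>H \<times>\<times> K\<^esub> (2 :: nat) \<otimes>\<^bsub>H \<times>\<times> K\<^esub> x = inv\<^bsub>H \<times>\<times> K\<^esub> g"
    if g: "g \<in> carrier (H \<times>\<times> K)" for g
  proof -
    obtain h k where hk: "g = (h, k)" "h \<in> carrier H" "k \<in> carrier K" using g by (auto simp: DirProd_def)
    obtain x where x: "x \<in> carrier H" "inv\<^bsub>H\<^esub> x \<otimes>\<^bsub>H\<^esub> h [^]\<^bsub>H\<^esub> (2 :: nat) \<otimes>\<^bsub>H\<^esub> x = inv\<^bsub>H\<^esub> h"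
      using H.cut_property_three_group_iff[OF mn(1)] assms(7) hk(2) by blast
    obtain y where y: "y \<in> carrier K" "inv\<^bsub>K\<^esub> y \<otimes>\<^bsub>K\<^esub> k [^]\<^bsub>K\<^esub> (2 :: nat) \<otimes>\<^bsub>K\<^esub> y = inv\<^bsub>K\<^esub> k"
      using K.cut_property_three_group_iff[OF mn(2)] assms(8) hk(3) by blast
    have "inv\<^bsub>H \<times>\<times> K\<^esub> (x, y) \<otimes>\<^bsub>H \<times>\<times> K\<^esub> g [^]\<^bsub>H \<times>\<times> K\<^esub> (2 :: nat) \<otimes>\<^bsub>H \<times>\<times> K\<^esub> (x, y) = inv\<^bsub>H \<times>\<times> K\<^esub> g"
      using x y hk assms(1,4) by (simp add: inv_DirProd numeral_eq_Suc)
    then show ?thesis using x(1) y(1) by (intro bexI[of _ "(x, y)"]) simp_all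
  qed
  then show ?thesis using HK.cut_property_three_group_iff[OF order] by blast
qed

end
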